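(* Let $(M,g)$ be an $n$-dimensional pseudo-Riemannian manifold ($n\ge 3$) and let $\alpha:I\to M$, $\alpha=\alpha(s)$, be a (non-null) proper curve of order $n$ with first curvature $k_1$ and harmonic curvature functions $H_0^*=0,H_1^*,\dots,H_{n-2}^*$. Then $\alpha$ is a $V_n$-slant helix in $M$ if and only if $(H_{n-2}^{*})'=k_1H_{n-3}^*$ and $H_{n-2}^*\neq 0$.
   Context: A pseudo-Riemannian manifold $(M,g)$ is a smooth manifold with a symmetric non-degenerate $(0,2)$ tensor field $g$; $\nabla$ is its Levi-Civita connection and $\|X\|=\sqrt{|g(X,X)|}$. Proper curve of order $n$: a non-null curve $\alpha:I\to M$ in an $n$-dimensional $M$, parametrized by arclength $s$ on an open interval $I\subset\mathbb{R}$, with unit tangent field $V_1$ and a Frenet frame field $V_1,\dots,V_n$ along $\alpha$ (pairwise $g$-orthogonal, with $\varepsilon_{j-1}=g(V_j,V_j)=\pm1$ on $I$ for $1\le j\le n$) satisfying the Frenet formulas $$\nabla_{V_1}V_1=k_1V_2,\qquad \nabla_{V_1}V_i=-\varepsilon_{i-2}\varepsilon_{i-1}k_{i-1}V_{i-1}+k_iV_{i+1}\ (1<i<n),\qquad \nabla_{V_1}V_n=-\varepsilon_{n-2}\varepsilon_{n-1}k_{n-1}V_{n-1},$$ where $k_1=\|\nabla_{V_1}V_1\|>0$ and $k_i=\|\nabla_{V_1}V_i+\varepsilon_{i-2}\varepsilon_{i-1}k_{i-1}V_{i-1}\|>0$ for $2\le i\le n-1$. The function $k_i$ is the $i$-th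 curvature of $\alpha$. Harmonic curvature functions $H_i^*:I\to\mathbb{R}$ of $\alpha$: $$H_0^*=0,\qquad H_1^*=\varepsilon_{n-3}\varepsilon_{n-2}\frac{k_{n-1}}{k_{n-2}},\qquad H_i^*=\left(k_{n-i}H_{i-2}^*-(H_{i-1}^* )'\right)\frac{\varepsilon_{n-(i+2)}\varepsilon_{n-(i+1)}}{k_{n-(i+1)}}\quad(2\le i\le n-2),$$ where $'$ denotes the derivative with respect to $s$ (i.e. in the direction $V_1$). $V_n$-slant helix: a proper curve $\alpha$ of order $n$ for which there is a vector field $X$ of $M$ that is parallel along $\alpha$ (i.e. $\nabla_{V_1}X=0$) and such that the function $g(V_n,X)$ is a non-zero constant along $\alpha$. Such an $X$ is called the axis of $\alpha$.
   Formalization: The axis X is a smooth vector field along α, not a vector field of M (such a field need not exist, e.g. at self-intersections of α), and H*_{n-2} ≠ 0 means that H*_{n-2} is not identically zero on I (the pointwise reading is false). *)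

theory Defs
  imports "HOL-Analysis.Analysis" "HOL-Library.Function_Algebras"
begin

section \<open>Pointwise linear structure on functions\<close>

instantiation "fun" :: (type, real_vector) real_vector
begin

definition scaleR_fun :: "real \<Rightarrow> ('a \<Rightarrow> 'b) \<Rightarrow> 'a \<Rightarrow> 'b"
  where "scaleR_fun r f = (\<lambda>x. r *\<^sub>R f x)"

instance
  by standard (simp_all add: scaleR_fun_def fun_eq_iff algebra_simps)

end

section \<open>Smooth maps between open subsets of Euclidean spaces\<close>

primrec times_differentiable_on ::
    "nat \<Rightarrow> 'b::real_normed_vector set \<Rightarrow> ('b \<Rightarrow> 'c::real_normed_vector) \<Rightarrow> bool"
where
  "times_differentiable_on 0 S f \<longleftrightarrow> continuous_on S f"
| "times_differentiable_on (Suc m) S f \<longleftrightarrow>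
     (\<forall>x\<in>S. f differentiable (at x)) \<and>
     (\<forall>w. times_differentiable_on m S (\<lambda>x. frechet_derivative f (at x) w))"

text \<open>Only meant for open \<open>S\<close>: the derivatives are two-sided.\<close>

definition smooth_on :: "'b::real_normed_vector set \<Rightarrow> ('b \<Rightarrow> 'c::real_normed_vector) \<Rightarrow> bool"
  where "smooth_on S f \<longleftrightarrow> (\<forall>m. times_differentiable_on m S f)"

section \<open>Smooth manifolds\<close>

text \<open>A chart is its domain together with its coordinate map, whose values off the domain
  are irrelevant.  A smooth structure is given by any (not necessarily maximal) smooth atlas;
  the dimension of the manifold is that of the model space \<open>'e\<close>.\<close>

type_synonym ('a, 'e) chart = "'a set \<times> ('a \<Rightarrow> 'e)"

abbreviation chart_dom :: "('a, 'e) chart \<Rightarrow> 'a set"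
  where "chart_dom c \<equiv> fst c"

abbreviation chart_map :: "('a, 'e) chart \<Rightarrow> 'a \<Rightarrow> 'e"
  where "chart_map c \<equiv> snd c"

definition chart_inv :: "('a, 'e) chart \<Rightarrow> 'e \<Rightarrow> 'a"
  where "chart_inv c = inv_into (chart_dom c) (chart_map c)"

definition transition :: "('a, 'e) chart \<Rightarrow> ('a, 'e) chart \<Rightarrow> 'e \<Rightarrow> 'e"
  where "transition c d = chart_map d \<circ> chart_inv c"

definition is_chart :: "'a topology \<Rightarrow> ('a, 'e::euclidean_space) chart \<Rightarrow> bool"
where
  "is_chart M c \<longleftrightarrow>
     openin M (chart_dom c) \<and> open (chart_map c ` chart_dom c) \<and>
     homeomorphic_map (subtopology M (chart_dom c)) (top_of_set (chart_map c ` chart_dom c))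
       (chart_map c)"

locale smooth_manifold =
  fixes M :: "'a topology" and A :: "('a, 'e::euclidean_space) chart set"
  assumes Hausdorff: "Hausdorff_space M"
    and second_countable: "second_countable M"
    and charts: "c \<in> A \<Longrightarrow> is_chart M c"
    and charts_cover: "(\<Union>c\<in>A. chart_dom c) = topspace M"
    and smooth_transition:
      "c \<in> A \<Longrightarrow> d \<in> A \<Longrightarrow>
        smooth_on (chart_map c ` (chart_dom c \<inter> chart_dom d)) (transition c d)"

section \<open>Tangent vectors and vector fields\<close>

text \<open>A tangent vector at \<open>p\<close> is the family of its component vectors in the charts around
  \<open>p\<close>, any two of which are related by the derivative of the change of coordinates; the family
  is normalised to \<open>0\<close> off these charts, so that equality is equality of tangent vectors.\<close>

type_synonym ('a, 'e) tvec = "('a, 'e) chart \<Rightarrow> 'e"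

definition tangent_space :: "('a, 'e::euclidean_space) chart set \<Rightarrow> 'a \<Rightarrow> ('a, 'e) tvec set"
where
  "tangent_space A p =
     {v. (\<forall>c. c \<notin> A \<or> p \<notin> chart_dom c \<longrightarrow> v c = 0) \<and>
         (\<forall>c\<in>A. \<forall>d\<in>A. p \<in> chart_dom c \<and> p \<in> chart_dom d \<longrightarrow>
            v d = frechet_derivative (transition c d) (at (chart_map c p)) (v c))}"

definition smooth_function ::
    "('a, 'e::euclidean_space) chart set \<Rightarrow> 'a set \<Rightarrow> ('a \<Rightarrow> real) \<Rightarrow> bool"
where
  "smooth_function A W f \<longleftrightarrow>
     (\<forall>c\<in>A. smooth_on (chart_map c ` (chart_dom c \<inter> W)) (f \<circ> chart_inv c))"

definition vector_field_on ::
    "('a, 'e::euclidean_space) chart set \<Rightarrow> 'a set \<Rightarrow> ('a \<Rightarrow> ('a, 'e) tvec) \<Rightarrow> bool"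
where
  "vector_field_on A W Y \<longleftrightarrow>
     (\<forall>p\<in>W. Y p \<in> tangent_space A p) \<and>
     (\<forall>c\<in>A. smooth_on (chart_map c ` (chart_dom c \<inter> W)) (\<lambda>x. Y (chart_inv c x) c))"

text \<open>The derivative \<open>v(f)\<close> of a function \<open>f\<close> in the direction of a tangent vector \<open>v\<close> at
  \<open>p\<close>, computed in a chart \<open>c\<close> around \<open>p\<close>, on which it does not depend.\<close>

definition dir_deriv ::
    "('a, 'e::euclidean_space) chart \<Rightarrow> 'a \<Rightarrow> ('a, 'e) tvec \<Rightarrow> ('a \<Rightarrow> real) \<Rightarrow> real"
where
  "dir_deriv c p v f = frechet_derivative (f \<circ> chart_inv c) (at (chart_map c p)) (v c)"

definition lie_bracket ::
    "('a, 'e::euclidean_space) chart set \<Rightarrow> ('a \<Rightarrow> ('a, 'e) tvec) \<Rightarrow> ('a \<Rightarrow> ('a, 'e) tvec) \<Rightarrow>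
     'a \<Rightarrow> ('a, 'e) tvec"
where
  "lie_bracket A X Y p = (\<lambda>c. if c \<in> A \<and> p \<in> chart_dom c
     then frechet_derivative (\<lambda>x. Y (chart_inv c x) c) (at (chart_map c p)) (X p c)
        - frechet_derivative (\<lambda>x. X (chart_inv c x) c) (at (chart_map c p)) (Y p c)
     else 0)"

section \<open>Pseudo-Riemannian metrics and the Levi-Civita connection\<close>

locale pseudo_riemannian_manifold = smooth_manifold M A
  for M :: "'a topology" and A :: "('a, 'e::euclidean_space) chart set" +
  fixes g :: "'a \<Rightarrow> ('a, 'e) tvec \<Rightarrow> ('a, 'e) tvec \<Rightarrow> real"
  assumes metric_add_left:
      "\<lbrakk>p \<in> topspace M; u \<in> tangent_space A p; v \<in> tangent_space A p; w \<in> tangent_space A p\<rbrakk>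
        \<Longrightarrow> g p (u + v) w = g p u w + g p v w"
    and metric_scale_left:
      "\<lbrakk>p \<in> topspace M; u \<in> tangent_space A p; w \<in> tangent_space A p\<rbrakk>
        \<Longrightarrow> g p (r *\<^sub>R u) w = r * g p u w"
    and metric_sym:
      "\<lbrakk>p \<in> topspace M; u \<in> tangent_space A p; w \<in> tangent_space A p\<rbrakk> \<Longrightarrow> g p u w = g p w u"
    and metric_nondegenerate:
      "\<lbrakk>p \<in> topspace M; u \<in> tangent_space A p; \<forall>w\<in>tangent_space A p. g p u w = 0\<rbrakk> \<Longrightarrow> u = 0"
    and metric_smooth:
      "\<lbrakk>openin M W; vector_field_on A W Y; vector_field_on A W Z\<rbrakk>
        \<Longrightarrow> smooth_function A W (\<lambda>p. g p (Y p) (Z p))"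

text \<open>An affine connection assigns to a tangent vector \<open>v\<close> at \<open>p\<close> and a vector field \<open>Y\<close>
  defined near \<open>p\<close> the covariant derivative \<open>nabla p v Y\<close>, a tangent vector at \<open>p\<close>.  Fields on
  arbitrary open sets are admitted, so that the locality of a connection is part of the
  definition and needs no extension by bump functions.\<close>

locale affine_connection = smooth_manifold M A
  for M :: "'a topology" and A :: "('a, 'e::euclidean_space) chart set" +
  fixes nabla :: "'a \<Rightarrow> ('a, 'e) tvec \<Rightarrow> ('a \<Rightarrow> ('a, 'e) tvec) \<Rightarrow> ('a, 'e) tvec"
  assumes nabla_tangent:
      "\<lbrakk>openin M W; p \<in> W; v \<in> tangent_space A p; vector_field_on A W Y\<rbrakk>
        \<Longrightarrow> nabla p v Y \<in> tangent_space A p"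
    and nabla_local:
      "\<lbrakk>openin M W; p \<in> W; v \<in> tangent_space A p; vector_field_on A W Y; vector_field_on A W Z;
        \<forall>q\<in>W. Y q = Z q\<rbrakk> \<Longrightarrow> nabla p v Y = nabla p v Z"
    and nabla_smooth:
      "\<lbrakk>openin M W; vector_field_on A W X; vector_field_on A W Y\<rbrakk>
        \<Longrightarrow> vector_field_on A W (\<lambda>q. nabla q (X q) Y)"
    and nabla_add_left:
      "\<lbrakk>openin M W; p \<in> W; u \<in> tangent_space A p; v \<in> tangent_space A p; vector_field_on A W Y\<rbrakk>
        \<Longrightarrow> nabla p (u + v) Y = nabla p u Y + nabla p v Y"
    and nabla_scale_left:
      "\<lbrakk>openin M W; p \<in> W; v \<in> tangent_space A p; vector_field_on A W Y\<rbrakk>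
        \<Longrightarrow> nabla p (r *\<^sub>R v) Y = r *\<^sub>R nabla p v Y"
    and nabla_add_right:
      "\<lbrakk>openin M W; p \<in> W; v \<in> tangent_space A p; vector_field_on A W Y; vector_field_on A W Z\<rbrakk>
        \<Longrightarrow> nabla p v (\<lambda>q. Y q + Z q) = nabla p v Y + nabla p v Z"
    and nabla_Leibniz:
      "\<lbrakk>openin M W; p \<in> W; v \<in> tangent_space A p; vector_field_on A W Y; smooth_function A W f;
        c \<in> A; p \<in> chart_dom c\<rbrakk>
        \<Longrightarrow> nabla p v (\<lambda>q. f q *\<^sub>R Y q) = dir_deriv c p v f *\<^sub>R Y p + f p *\<^sub>R nabla p v Y"

locale levi_civita_connection =
  pseudo_riemannian_manifold M A g + affine_connection M A nabla
  for M :: "'a topology" and A :: "('a, 'e::euclidean_space) chart set" and g nabla +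
  assumes torsion_free:
      "\<lbrakk>openin M W; p \<in> W; vector_field_on A W X; vector_field_on A W Y\<rbrakk>
        \<Longrightarrow> nabla p (X p) Y - nabla p (Y p) X = lie_bracket A X Y p"
    and metric_compatible:
      "\<lbrakk>openin M W; p \<in> W; v \<in> tangent_space A p; vector_field_on A W Y; vector_field_on A W Z;
        c \<in> A; p \<in> chart_dom c\<rbrakk>
        \<Longrightarrow> dir_deriv c p v (\<lambda>q. g q (Y q) (Z q))
            = g p (nabla p v Y) (Z p) + g p (Y p) (nabla p v Z)"

section \<open>Curves and fields along curves\<close>

definition smooth_curve ::
    "'a topology \<Rightarrow> ('a, 'e::euclidean_space) chart set \<Rightarrow> real set \<Rightarrow> (real \<Rightarrow> 'a) \<Rightarrow> bool"
where
  "smooth_curve M A I \<alpha> \<longleftrightarrow>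
     continuous_map (top_of_set I) M \<alpha> \<and>
     (\<forall>c\<in>A. smooth_on {s\<in>I. \<alpha> s \<in> chart_dom c} (\<lambda>s. chart_map c (\<alpha> s)))"

definition velocity ::
    "('a, 'e::euclidean_space) chart set \<Rightarrow> (real \<Rightarrow> 'a) \<Rightarrow> real \<Rightarrow> ('a, 'e) tvec"
where
  "velocity A \<alpha> s = (\<lambda>c. if c \<in> A \<and> \<alpha> s \<in> chart_dom c
     then vector_derivative (\<lambda>t. chart_map c (\<alpha> t)) (at s) else 0)"

definition vector_field_along ::
    "('a, 'e::euclidean_space) chart set \<Rightarrow> real set \<Rightarrow> (real \<Rightarrow> 'a) \<Rightarrow>
     (real \<Rightarrow> ('a, 'e) tvec) \<Rightarrow> bool"
where
  "vector_field_along A I \<alpha> X \<longleftrightarrow>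
     (\<forall>s\<in>I. X s \<in> tangent_space A (\<alpha> s)) \<and>
     (\<forall>c\<in>A. smooth_on {s\<in>I. \<alpha> s \<in> chart_dom c} (\<lambda>s. X s c))"

text \<open>The vector field on the domain of \<open>c\<close> whose components in \<open>c\<close> are constantly \<open>w\<close>.\<close>

definition coord_field ::
    "('a, 'e::euclidean_space) chart set \<Rightarrow> ('a, 'e) chart \<Rightarrow> 'e \<Rightarrow> 'a \<Rightarrow> ('a, 'e) tvec"
where
  "coord_field A c w p = (\<lambda>d. if d \<in> A \<and> p \<in> chart_dom c \<and> p \<in> chart_dom d
     then frechet_derivative (transition c d) (at (chart_map c p)) w else 0)"

text \<open>The covariant derivative of \<open>X\<close> along \<open>\<alpha>\<close>.  Writing \<open>X = (\<Sum>b. X\<^sup>b E\<^sub>b)\<close> in the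
  coordinate frame \<open>E\<^sub>b\<close> of \<open>c\<close>, it is \<open>(\<Sum>b. (X\<^sup>b)' E\<^sub>b + X\<^sup>b nabla\<^sub>\<alpha>\<^sub>' E\<^sub>b)\<close>; at the fixed
  parameter \<open>s\<close> the second part is the derivative of the single field
  \<open>(\<Sum>b. X\<^sup>b(s) E\<^sub>b)\<close> with constant components.\<close>

definition cov_deriv ::
    "('a, 'e::euclidean_space) chart set \<Rightarrow>
     ('a \<Rightarrow> ('a, 'e) tvec \<Rightarrow> ('a \<Rightarrow> ('a, 'e) tvec) \<Rightarrow> ('a, 'e) tvec) \<Rightarrow>
     (real \<Rightarrow> 'a) \<Rightarrow> (real \<Rightarrow> ('a, 'e) tvec) \<Rightarrow> real \<Rightarrow> ('a, 'e) tvec"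
where
  "cov_deriv A nabla \<alpha> X s = (\<lambda>c. if c \<in> A \<and> \<alpha> s \<in> chart_dom c
     then vector_derivative (\<lambda>t. X t c) (at s)
        + nabla (\<alpha> s) (velocity A \<alpha> s) (coord_field A c (X s c)) c
     else 0)"

definition pnorm ::
    "('a \<Rightarrow> ('a, 'e) tvec \<Rightarrow> ('a, 'e) tvec \<Rightarrow> real) \<Rightarrow> 'a \<Rightarrow> ('a, 'e) tvec \<Rightarrow> real"
  where "pnorm g p v = sqrt \<bar>g p v v\<bar>"

section \<open>Proper curves, harmonic curvatures and slant helices\<close>

text \<open>The frame is \<open>V 1, \<dots>, V n\<close>, the signs are \<open>\<epsilon> 0, \<dots>, \<epsilon> (n - 1)\<close> and the curvatures are
  \<open>k 1, \<dots>, k (n - 1)\<close>; other indices are unconstrained.  All three are determined on \<open>I\<close> by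
  the curve.  That \<open>\<alpha>\<close> is non-null and parametrised by arclength is the case \<open>j = 1\<close> of
  \<open>frame_unit\<close>.\<close>

locale proper_curve = levi_civita_connection M A g nabla
  for M :: "'a topology" and A :: "('a, 'e::euclidean_space) chart set" and g nabla +
  fixes n :: nat and I :: "real set" and \<alpha> :: "real \<Rightarrow> 'a"
    and V :: "nat \<Rightarrow> real \<Rightarrow> ('a, 'e) tvec"
    and \<epsilon> :: "nat \<Rightarrow> real" and k :: "nat \<Rightarrow> real \<Rightarrow> real"
  assumes order: "n = DIM('e)"
    and interval: "open I" "is_interval I" "I \<noteq> {}"
    and curve: "smooth_curve M A I \<alpha>"
    and frame_field: "1 \<le> j \<Longrightarrow> j \<le> n \<Longrightarrow> vector_field_along A I \<alpha> (V j)"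
    and tangent: "s \<in> I \<Longrightarrow> V 1 s = velocity A \<alpha> s"
    and frame_orthogonal:
      "\<lbrakk>s \<in> I; 1 \<le> i; i \<le> n; 1 \<le> j; j \<le> n; i \<noteq> j\<rbrakk> \<Longrightarrow> g (\<alpha> s) (V i s) (V j s) = 0"
    and sign: "1 \<le> j \<Longrightarrow> j \<le> n \<Longrightarrow> \<epsilon> (j - 1) = 1 \<or> \<epsilon> (j - 1) = -1"
    and frame_unit:
      "\<lbrakk>s \<in> I; 1 \<le> j; j \<le> n\<rbrakk> \<Longrightarrow> g (\<alpha> s) (V j s) (V j s) = \<epsilon> (j - 1)"
    and Frenet_first:
      "s \<in> I \<Longrightarrow> cov_deriv A nabla \<alpha> (V 1) s = k 1 s *\<^sub>R V 2 s"
    and Frenet_middle: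
      "\<lbrakk>s \<in> I; 1 < i; i < n\<rbrakk> \<Longrightarrow> cov_deriv A nabla \<alpha> (V i) s
        = - (\<epsilon> (i - 2) * \<epsilon> (i - 1) * k (i - 1) s) *\<^sub>R V (i - 1) s + k i s *\<^sub>R V (i + 1) s"
    and Frenet_last:
      "s \<in> I \<Longrightarrow> cov_deriv A nabla \<alpha> (V n) s
        = - (\<epsilon> (n - 2) * \<epsilon> (n - 1) * k (n - 1) s) *\<^sub>R V (n - 1) s"
    and curvature_first:
      "s \<in> I \<Longrightarrow> k 1 s = pnorm g (\<alpha> s) (cov_deriv A nabla \<alpha> (V 1) s)"
    and curvature:
      "\<lbrakk>s \<in> I; 2 \<le> i; i \<le> n - 1\<rbrakk> \<Longrightarrow> k i s = pnorm g (\<alpha> s)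
        (cov_deriv A nabla \<alpha> (V i) s + (\<epsilon> (i - 2) * \<epsilon> (i - 1) * k (i - 1) s) *\<^sub>R V (i - 1) s)"
    and curvature_pos: "\<lbrakk>s \<in> I; 1 \<le> i; i \<le> n - 1\<rbrakk> \<Longrightarrow> k i s > 0"

text \<open>Meant for indices up to \<open>n - 2\<close>.  The last clause is the recursion for the index
  \<open>i = j + 2\<close>.\<close>

fun harmonic_curvature ::
    "nat \<Rightarrow> (nat \<Rightarrow> real) \<Rightarrow> (nat \<Rightarrow> real \<Rightarrow> real) \<Rightarrow> nat \<Rightarrow> (real \<Rightarrow> real)"
where
  "harmonic_curvature n \<epsilon> k 0 = (\<lambda>s. 0)"
| "harmonic_curvature n \<epsilon> k (Suc 0) =
     (\<lambda>s. \<epsilon> (n - 3) * \<epsilon> (n - 2) * (k (n - 1) s / k (n - 2) s))"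
| "harmonic_curvature n \<epsilon> k (Suc (Suc j)) =
     (\<lambda>s. (k (n - (j + 2)) s * harmonic_curvature n \<epsilon> k j s
            - deriv (harmonic_curvature n \<epsilon> k (Suc j)) s)
          * (\<epsilon> (n - (j + 4)) * \<epsilon> (n - (j + 3)) / k (n - (j + 3)) s))"

text \<open>The axis is a vector field along the curve: a field on \<open>M\<close> restricting to it need not
  exist, for instance at self-intersections of the curve.\<close>

definition slant_helix ::
    "'a topology \<Rightarrow> ('a, 'e::euclidean_space) chart set \<Rightarrow>
     ('a \<Rightarrow> ('a, 'e) tvec \<Rightarrow> ('a, 'e) tvec \<Rightarrow> real) \<Rightarrow>
     ('a \<Rightarrow> ('a, 'e) tvec \<Rightarrow> ('a \<Rightarrow> ('a, 'e) tvec) \<Rightarrow> ('a, 'e) tvec) \<Rightarrow>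
     nat \<Rightarrow> real set \<Rightarrow> (real \<Rightarrow> 'a) \<Rightarrow> (nat \<Rightarrow> real \<Rightarrow> ('a, 'e) tvec) \<Rightarrow>
     (nat \<Rightarrow> real) \<Rightarrow> (nat \<Rightarrow> real \<Rightarrow> real) \<Rightarrow> bool"
where
  "slant_helix M A g nabla n I \<alpha> V \<epsilon> k \<longleftrightarrow>
     proper_curve M A g nabla n I \<alpha> V \<epsilon> k \<and>
     (\<exists>X. vector_field_along A I \<alpha> X \<and>
          (\<forall>s\<in>I. cov_deriv A nabla \<alpha> X s = 0) \<and>
          (\<exists>r. r \<noteq> 0 \<and> (\<forall>s\<in>I. g (\<alpha> s) (V n s) (X s) = r)))"

end

theory Submission
  imports Defs
begin

text \<open>The frame is an orthonormal basis of each tangent space, so every field along the curve is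
  \<open>X = (\<Sum>i. \<epsilon>\<^sub>i\<^sub>-\<^sub>1 x\<^sub>i V\<^sub>i)\<close> with \<open>x\<^sub>i = g (V\<^sub>i, X)\<close>, and by the Frenet formulas \<open>X\<close> is parallel
  iff the \<open>x\<^sub>i\<close> solve a linear system of the same shape.  If \<open>x\<^sub>n\<close> is a constant \<open>r\<close>, the equations,
  taken from the last one up, determine \<open>x\<^sub>n\<^sub>-\<^sub>1\<^sub>-\<^sub>i = r H\<^sub>i\<close>, the recursion of the harmonic curvatures
  being exactly the equation for \<open>x\<^sub>n\<^sub>-\<^sub>i\<close> solved for \<open>x\<^sub>n\<^sub>-\<^sub>1\<^sub>-\<^sub>i\<close>; the only equation left is the one
  for \<open>x\<^sub>1\<close>, which is the condition on \<open>H\<^sub>n\<^sub>-\<^sub>2\<close>.  If \<open>H\<^sub>n\<^sub>-\<^sub>2\<close> vanished identically, so would \<open>x\<^sub>1\<close>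
  and then, going down the system, all \<open>x\<^sub>i\<close>.\<close>

section \<open>Calculus of smooth maps\<close>

lemma times_differentiable_on_cong:
  assumes "open S" and "\<And>x. x \<in> S \<Longrightarrow> f x = h x" and "times_differentiable_on m S f"
  shows "times_differentiable_on m S h"
  using assms(2,3)
proof (induction m arbitrary: f h)
  case 0
  then have "continuous_on S h = continuous_on S f"
    by (intro continuous_on_cong) auto
  then show ?case
    using 0 by simp
next
  case (Suc m)
  have h: "(h has_derivative frechet_derivative f (at x)) (at x)" if "x \<in> S" for x
  proof (rule has_derivative_transform_within_open[OF _ \<open>open S\<close> that])
    show "(f has_derivative frechet_derivative f (at x)) (at x)"
      using Suc.prems(2) that by (simp add: frechet_derivative_works[symmetric])
  qed (rule Suc.prems(1))
  have "times_differentiable_on m S (\<lambda>x. frechet_derivative h (at x) w)" for w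
  proof (rule Suc.IH)
    show "frechet_derivative f (at x) w = frechet_derivative h (at x) w" if "x \<in> S" for x
      by (simp only: frechet_derivative_at[OF h[OF that]])
    show "times_differentiable_on m S (\<lambda>x. frechet_derivative f (at x) w)"
      using Suc.prems(2) by simp
  qed
  then show ?case
    using differentiableI[OF h] by simp
qed

lemma times_differentiable_on_SucI:
  assumes "open S"
    and "\<And>x. x \<in> S \<Longrightarrow> (f has_derivative f' x) (at x)"
    and "\<And>w. times_differentiable_on m S (\<lambda>x. f' x w)"
  shows "times_differentiable_on (Suc m) S f"
proof -
  have "f' x w = frechet_derivative f (at x) w" if "x \<in> S" for x w
    by (simp only: frechet_derivative_at[OF assms(2)[OF that]])
  from times_differentiable_on_cong[OF assms(1) this assms(3)]
  have "times_differentiable_on m S (\<lambda>x. frechet_derivative f (at x) w)" for w .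
  then show ?thesis
    using differentiableI[OF assms(2)] by simp
qed

lemma times_differentiable_on_has_derivative:
  assumes "times_differentiable_on (Suc m) S f" and "x \<in> S"
  shows "(f has_derivative frechet_derivative f (at x)) (at x)"
  using assms by (auto simp: frechet_derivative_works[symmetric])

lemma times_differentiable_on_derivative:
  "times_differentiable_on (Suc m) S f
    \<Longrightarrow> times_differentiable_on m S (\<lambda>x. frechet_derivative f (at x) w)"
  by simp

lemma times_differentiable_on_Suc_imp:
  "times_differentiable_on (Suc m) S f \<Longrightarrow> times_differentiable_on m S f"
proof (induction m arbitrary: f)
  case 0
  then show ?case
    by (auto intro!: continuous_at_imp_continuous_on differentiable_imp_continuous_within)
next
  case (Suc m)
  have "times_differentiable_on m S (\<lambda>x. frechet_derivative f (at x) w)" for w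
    by (rule Suc.IH[OF times_differentiable_on_derivative[OF Suc.prems]])
  moreover have "\<forall>x\<in>S. f differentiable (at x)"
    using Suc.prems unfolding times_differentiable_on.simps(2)[of "Suc m"] by (rule conjunct1)
  ultimately show ?case
    unfolding times_differentiable_on.simps(2)[of m] by blast
qed

lemma times_differentiable_on_local:
  assumes "\<And>x. x \<in> S \<Longrightarrow> \<exists>U. open U \<and> x \<in> U \<and> times_differentiable_on m U f"
  shows "times_differentiable_on m S f"
  using assms
proof (induction m arbitrary: f)
  case 0
  have "isCont f x" if x: "x \<in> S" for x
  proof -
    obtain U where "open U" "x \<in> U" "continuous_on U f"
      using 0 x by auto
    then show ?thesis
      by (simp add: continuous_on_eq_continuous_at)
  qed
  then show ?case
    by (simp add: continuous_at_imp_continuous_on)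
next
  case (Suc m)
  have "times_differentiable_on m S (\<lambda>x. frechet_derivative f (at x) w)" for w
  proof (rule Suc.IH)
    fix x assume "x \<in> S"
    from Suc.prems[OF this] times_differentiable_on_derivative
    show "\<exists>U. open U \<and> x \<in> U
        \<and> times_differentiable_on m U (\<lambda>x. frechet_derivative f (at x) w)"
      by blast
  qed
  moreover have "f differentiable (at x)" if "x \<in> S" for x
    using Suc.prems[OF that] by auto
  ultimately show ?case by simp
qed

lemma times_differentiable_on_subset:
  assumes "times_differentiable_on m S f" and "T \<subseteq> S"
  shows "times_differentiable_on m T f"
  using assms by (induction m arbitrary: f) (auto intro: continuous_on_subset)

lemma times_differentiable_on_const: "open S \<Longrightarrow> times_differentiable_on m S (\<lambda>_. a)"
proof (induction m arbitrary: a)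
  case (Suc m)
  then show ?case
    by (intro times_differentiable_on_SucI[where f'="\<lambda>_ _. 0"] has_derivative_const)
qed simp

lemma times_differentiable_on_add:
  assumes "open S" and "times_differentiable_on m S f" and "times_differentiable_on m S h"
  shows "times_differentiable_on m S (\<lambda>x. f x + h x)"
  using assms
proof (induction m arbitrary: f h)
  case 0
  then show ?case by (auto intro: continuous_on_add)
next
  case (Suc m)
  show ?case
  proof (rule times_differentiable_on_SucI[OF \<open>open S\<close>])
    show "((\<lambda>x. f x + h x) has_derivative
        (\<lambda>w. frechet_derivative f (at x) w + frechet_derivative h (at x) w)) (at x)"
      if "x \<in> S" for x
      using Suc.prems(2,3) that
      by (intro has_derivative_add times_differentiable_on_has_derivative)
    show "times_differentiable_on m S
        (\<lambda>x. frechet_derivative f (at x) w + frechet_derivative h (at x) w)" for w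
      using Suc.prems by (intro Suc.IH) auto
  qed
qed

lemma times_differentiable_on_sum:
  assumes "open S" and "\<And>i. i \<in> J \<Longrightarrow> times_differentiable_on m S (f i)"
  shows "times_differentiable_on m S (\<lambda>x. \<Sum>i\<in>J. f i x)"
  using assms(2)
  by (induction J rule: infinite_finite_induct)
     (auto intro!: times_differentiable_on_add times_differentiable_on_const assms(1))

lemma times_differentiable_on_bilinear:
  assumes "bounded_bilinear B" and "open S"
    and "times_differentiable_on m S f" and "times_differentiable_on m S h"
  shows "times_differentiable_on m S (\<lambda>x. B (f x) (h x))"
  using assms(3,4)
proof (induction m arbitrary: f h)
  case 0
  then show ?case by (auto intro: bounded_bilinear.continuous_on[OF assms(1)])
next
  case (Suc m)
  show ?case
  proof (rule times_differentiable_on_SucI[OF \<open>open S\<close>])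
    show "((\<lambda>x. B (f x) (h x)) has_derivative
        (\<lambda>w. B (f x) (frechet_derivative h (at x) w) + B (frechet_derivative f (at x) w) (h x)))
        (at x)" if "x \<in> S" for x
      using Suc.prems that
      by (intro bounded_bilinear.FDERIV[OF assms(1)] times_differentiable_on_has_derivative)
    show "times_differentiable_on m S (\<lambda>x. B (f x) (frechet_derivative h (at x) w)
        + B (frechet_derivative f (at x) w) (h x))" for w
      using Suc.prems times_differentiable_on_Suc_imp[OF Suc.prems(1)]
        times_differentiable_on_Suc_imp[OF Suc.prems(2)]
      by (intro times_differentiable_on_add \<open>open S\<close> Suc.IH) auto
  qed
qed

lemma times_differentiable_on_compose:
  fixes f :: "'b::real_normed_vector \<Rightarrow> 'c::euclidean_space"
  assumes "open S" and "open T" and "f ` S \<subseteq> T"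
    and "times_differentiable_on m S f" and "times_differentiable_on m T h"
  shows "times_differentiable_on m S (\<lambda>x. h (f x))"
  using assms(4,5)
proof (induction m arbitrary: h)
  case 0
  then show ?case using assms(3) by (auto intro: continuous_on_compose2)
next
  case (Suc m)
  let ?f' = "\<lambda>x. frechet_derivative f (at x)" and ?h' = "\<lambda>y. frechet_derivative h (at y)"
  show ?case
  proof (rule times_differentiable_on_SucI[OF \<open>open S\<close>])
    fix x assume x: "x \<in> S"
    have h': "(h has_derivative ?h' (f x)) (at (f x))"
      using Suc.prems(2) x assms(3) by (intro times_differentiable_on_has_derivative) auto
    have expand: "?h' (f x) v = (\<Sum>b\<in>Basis. (v \<bullet> b) *\<^sub>R ?h' (f x) b)" for v
    proof -
      have lin: "linear (?h' (f x))"
        using h' has_derivative_linear by blast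
      have "?h' (f x) v = ?h' (f x) (\<Sum>b\<in>Basis. (v \<bullet> b) *\<^sub>R b)"
        by (simp add: euclidean_representation)
      then show ?thesis
        by (simp add: linear_sum[OF lin] linear_scale[OF lin])
    qed
    have "((\<lambda>x. h (f x)) has_derivative (\<lambda>w. ?h' (f x) (?f' x w))) (at x)"
      by (rule has_derivative_compose[OF times_differentiable_on_has_derivative[OF Suc.prems(1) x] h'])
    also have "(\<lambda>w. ?h' (f x) (?f' x w)) = (\<lambda>w. \<Sum>b\<in>Basis. (?f' x w \<bullet> b) *\<^sub>R ?h' (f x) b)"
      by (rule ext) (rule expand)
    finally show "((\<lambda>x. h (f x)) has_derivative
        (\<lambda>w. \<Sum>b\<in>Basis. (?f' x w \<bullet> b) *\<^sub>R ?h' (f x) b)) (at x)" .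
  next
    fix w
    have "times_differentiable_on m S (\<lambda>x. ?h' (f x) b)" for b
      using Suc.prems times_differentiable_on_Suc_imp[OF Suc.prems(1)]
      by (intro Suc.IH) auto
    then show "times_differentiable_on m S
        (\<lambda>x. \<Sum>b\<in>Basis. (?f' x w \<bullet> b) *\<^sub>R ?h' (f x) b)"
      using Suc.prems(1)
      by (intro times_differentiable_on_sum \<open>open S\<close> times_differentiable_on_const
          times_differentiable_on_bilinear[OF bounded_bilinear_scaleR]
          times_differentiable_on_bilinear[OF bounded_bilinear_inner]) auto
  qed
qed

lemma times_differentiable_on_inverse:
  "times_differentiable_on m (- {0}) (inverse :: real \<Rightarrow> real)"
proof (induction m)
  case 0
  then show ?case by (auto intro: continuous_on_inverse)
next
  case (Suc m)
  show ?case
  proof (rule times_differentiable_on_SucI)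
    show "(inverse has_derivative (\<lambda>w. (inverse x * inverse x) * (- w))) (at x)"
      if "x \<in> - {0}" for x :: real
      using has_derivative_inverse'[of x UNIV] that by (simp add: mult_ac)
    show "times_differentiable_on m (- {0}) (\<lambda>x::real. (inverse x * inverse x) * (- w))" for w
      by (intro times_differentiable_on_bilinear[OF bounded_bilinear_mult] Suc
          times_differentiable_on_const) auto
  qed auto
qed

lemma smooth_on_cong:
  "open S \<Longrightarrow> (\<And>x. x \<in> S \<Longrightarrow> f x = h x) \<Longrightarrow> smooth_on S f \<Longrightarrow> smooth_on S h"
  unfolding smooth_on_def by (blast intro: times_differentiable_on_cong)

lemma smooth_on_local:
  assumes "\<And>x. x \<in> S \<Longrightarrow> \<exists>U. open U \<and> x \<in> U \<and> smooth_on U f"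
  shows "smooth_on S f"
  unfolding smooth_on_def
proof
  show "times_differentiable_on m S f" for m
    using assms unfolding smooth_on_def by (intro times_differentiable_on_local) blast
qed

lemma smooth_on_subset: "smooth_on S f \<Longrightarrow> T \<subseteq> S \<Longrightarrow> smooth_on T f"
  unfolding smooth_on_def using times_differentiable_on_subset by blast

lemma smooth_on_const: "open S \<Longrightarrow> smooth_on S (\<lambda>_. a)"
  by (simp add: smooth_on_def times_differentiable_on_const)

lemma smooth_on_add:
  "open S \<Longrightarrow> smooth_on S f \<Longrightarrow> smooth_on S h \<Longrightarrow> smooth_on S (\<lambda>x. f x + h x)"
  by (simp add: smooth_on_def times_differentiable_on_add)

lemma smooth_on_sum:
  "open S \<Longrightarrow> (\<And>i. i \<in> J \<Longrightarrow> smooth_on S (f i)) \<Longrightarrow> smooth_on S (\<lambda>x. \<Sum>i\<in>J. f i x)"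
  by (simp add: smooth_on_def times_differentiable_on_sum)

lemma smooth_on_bilinear:
  "bounded_bilinear B \<Longrightarrow> open S \<Longrightarrow> smooth_on S f \<Longrightarrow> smooth_on S h
    \<Longrightarrow> smooth_on S (\<lambda>x. B (f x) (h x))"
  by (simp add: smooth_on_def times_differentiable_on_bilinear)

lemmas smooth_on_scaleR = smooth_on_bilinear[OF bounded_bilinear_scaleR]
lemmas smooth_on_mult = smooth_on_bilinear[OF bounded_bilinear_mult]
lemmas smooth_on_inner = smooth_on_bilinear[OF bounded_bilinear_inner]

lemma smooth_on_diff:
  fixes f h :: "'b::real_normed_vector \<Rightarrow> real"
  assumes "open S" and "smooth_on S f" and "smooth_on S h"
  shows "smooth_on S (\<lambda>x. f x - h x)"
  using smooth_on_add[OF assms(1,2) smooth_on_mult[OF assms(1) smooth_on_const[OF assms(1), of "-1"] assms(3)]]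
  by simp

lemma smooth_on_compose:
  fixes f :: "'b::real_normed_vector \<Rightarrow> 'c::euclidean_space"
  shows "open S \<Longrightarrow> open T \<Longrightarrow> f ` S \<subseteq> T \<Longrightarrow> smooth_on S f \<Longrightarrow> smooth_on T h
    \<Longrightarrow> smooth_on S (\<lambda>x. h (f x))"
  by (simp add: smooth_on_def times_differentiable_on_compose)

lemma smooth_on_divide:
  fixes f h :: "'b::real_normed_vector \<Rightarrow> real"
  assumes "open S" and "smooth_on S f" and "smooth_on S h" and "\<And>x. x \<in> S \<Longrightarrow> h x \<noteq> 0"
  shows "smooth_on S (\<lambda>x. f x / h x)"
proof -
  have "smooth_on S (\<lambda>x. inverse (h x))"
    by (rule smooth_on_compose[where T="- {0}"])
       (use assms in \<open>auto simp: smooth_on_def times_differentiable_on_inverse\<close>)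
  then show ?thesis
    using assms by (simp add: divide_inverse smooth_on_mult)
qed

lemma smooth_on_frechet_derivative:
  "smooth_on S f \<Longrightarrow> smooth_on S (\<lambda>x. frechet_derivative f (at x) w)"
  unfolding smooth_on_def using times_differentiable_on.simps(2) by blast

lemma smooth_on_has_derivative:
  "smooth_on S f \<Longrightarrow> x \<in> S \<Longrightarrow> (f has_derivative frechet_derivative f (at x)) (at x)"
  unfolding smooth_on_def using times_differentiable_on_has_derivative by blast

lemma smooth_on_has_vector_derivative:
  assumes "smooth_on S f" and "s \<in> S"
  shows "(f has_vector_derivative vector_derivative f (at s)) (at s)"
  by (simp add: vector_derivative_works[symmetric] differentiableI[OF smooth_on_has_derivative[OF assms]])

lemma smooth_on_has_field_derivative:
  fixes f :: "real \<Rightarrow> real"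
  assumes "smooth_on S f" and "s \<in> S"
  shows "(f has_real_derivative deriv f s) (at s)"
  by (simp add: DERIV_deriv_iff_real_differentiable
      differentiableI[OF smooth_on_has_derivative[OF assms]])

lemma smooth_on_vector_derivative:
  assumes "open S" and "smooth_on S f"
  shows "smooth_on S (\<lambda>s. vector_derivative f (at s))"
proof (rule smooth_on_cong[OF assms(1) _ smooth_on_frechet_derivative[OF assms(2), of 1]])
  fix s assume "s \<in> S"
  have "(\<lambda>h. h *\<^sub>R vector_derivative f (at s)) = frechet_derivative f (at s)"
    using smooth_on_has_vector_derivative[OF assms(2) \<open>s \<in> S\<close>]
    unfolding has_vector_derivative_def by (rule frechet_derivative_at)
  then show "frechet_derivative f (at s) 1 = vector_derivative f (at s)"
    by (metis scaleR_one)
qed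

lemma smooth_on_deriv:
  fixes f :: "real \<Rightarrow> real"
  assumes "open S" and "smooth_on S f"
  shows "smooth_on S (deriv f)"
proof (rule smooth_on_cong[OF assms(1) _ smooth_on_vector_derivative[OF assms]])
  fix s assume "s \<in> S"
  from smooth_on_has_field_derivative[OF assms(2) this]
  show "vector_derivative f (at s) = deriv f s"
    by (simp add: has_real_derivative_iff_has_vector_derivative vector_derivative_at)
qed

lemma bilinear_expansion:
  fixes B :: "'b::euclidean_space \<Rightarrow> 'c::euclidean_space \<Rightarrow> 'd::real_vector"
  assumes "bilinear B"
  shows "B u v = (\<Sum>b\<in>Basis. \<Sum>d\<in>Basis. ((u \<bullet> b) * (v \<bullet> d)) *\<^sub>R B b d)"
proof -
  have "B u v = B (\<Sum>b\<in>Basis. (u \<bullet> b) *\<^sub>R b) (\<Sum>d\<in>Basis. (v \<bullet> d) *\<^sub>R d)"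
    by (simp add: euclidean_representation)
  then show ?thesis
    by (simp add: bilinear_sum[OF assms] sum.cartesian_product case_prod_unfold
        bilinear_lmul[OF assms] bilinear_rmul[OF assms] mult.commute)
qed

lemma smooth_on_bilinear_family:
  fixes B :: "'b::real_normed_vector \<Rightarrow> 'c::euclidean_space \<Rightarrow> 'd::euclidean_space
    \<Rightarrow> 'e::real_normed_vector"
  assumes "open S" and "\<And>x. x \<in> S \<Longrightarrow> bilinear (B x)"
    and "\<And>b d. smooth_on S (\<lambda>x. B x b d)"
    and "smooth_on S u" and "smooth_on S v"
  shows "smooth_on S (\<lambda>x. B x (u x) (v x))"
proof (rule smooth_on_cong[OF assms(1)])
  show "(\<Sum>b\<in>Basis. \<Sum>d\<in>Basis. ((u x \<bullet> b) * (v x \<bullet> d)) *\<^sub>R B x b d) = B x (u x) (v x)"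
    if "x \<in> S" for x
    by (rule bilinear_expansion[OF assms(2)[OF that], symmetric])
  show "smooth_on S
      (\<lambda>x. \<Sum>b\<in>Basis. \<Sum>d\<in>Basis. ((u x \<bullet> b) * (v x \<bullet> d)) *\<^sub>R B x b d)"
    by (intro smooth_on_sum smooth_on_scaleR smooth_on_mult smooth_on_inner smooth_on_const assms)
qed

section \<open>The scalar Frenet system\<close>

text \<open>The system satisfied by the functions \<open>x i = g (V i) X\<close> for a parallel field \<open>X\<close>.\<close>

definition frenet_system ::
    "nat \<Rightarrow> real set \<Rightarrow> (nat \<Rightarrow> real) \<Rightarrow> (nat \<Rightarrow> real \<Rightarrow> real) \<Rightarrow> (nat \<Rightarrow> real \<Rightarrow> real) \<Rightarrow> bool"
where
  "frenet_system n I \<epsilon> k x \<longleftrightarrow> (\<forall>s\<in>I.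
     (x 1 has_real_derivative k 1 s * x 2 s) (at s) \<and>
     (\<forall>i. 1 < i \<and> i < n \<longrightarrow> (x i has_real_derivative
        - (\<epsilon> (i - 2) * \<epsilon> (i - 1) * k (i - 1) s) * x (i - 1) s + k i s * x (i + 1) s) (at s)) \<and>
     (x n has_real_derivative - (\<epsilon> (n - 2) * \<epsilon> (n - 1) * k (n - 1) s) * x (n - 1) s) (at s))"

lemma has_real_derivative_congI:
  fixes f h :: "real \<Rightarrow> real"
  assumes "open S" and "s \<in> S" and "\<And>t. t \<in> S \<Longrightarrow> f t = h t" and "(f has_real_derivative d) (at s)"
  shows "(h has_real_derivative d) (at s)"
  using has_field_derivative_transform_within_open[OF assms(4,1,2)] assms(3) by blast

lemma has_real_derivative_const_on:
  fixes f :: "real \<Rightarrow> real"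
  assumes "open S" and "s \<in> S" and "\<And>t. t \<in> S \<Longrightarrow> f t = r" and "(f has_real_derivative d) (at s)"
  shows "d = 0"
  using has_real_derivative_congI[OF assms] DERIV_const[of r "at s"] DERIV_unique by blast

locale frenet_data =
  fixes n :: nat and I :: "real set" and \<epsilon> :: "nat \<Rightarrow> real" and k :: "nat \<Rightarrow> real \<Rightarrow> real"
  assumes n3: "n \<ge> 3" and open_I: "open I"
    and sign_sq: "j < n \<Longrightarrow> \<epsilon> j * \<epsilon> j = 1"
    and k_pos: "s \<in> I \<Longrightarrow> 1 \<le> i \<Longrightarrow> i < n \<Longrightarrow> k i s > 0"
begin

abbreviation "H \<equiv> harmonic_curvature n \<epsilon> k"

lemma sign_nonzero: "j < n \<Longrightarrow> \<epsilon> j \<noteq> 0"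
  using sign_sq by force

lemma sign_solve:
  assumes "i < n" "j < n" "c > 0" "d = - (\<epsilon> i * \<epsilon> j * c) * x + y"
  shows "x = (y - d) * (\<epsilon> i * \<epsilon> j / c)"
proof -
  have "(y - d) * (\<epsilon> i * \<epsilon> j / c) = (\<epsilon> i * \<epsilon> i) * (\<epsilon> j * \<epsilon> j) * x"
    using assms(3) unfolding assms(4) by (simp add: field_simps)
  then show ?thesis by (simp add: sign_sq assms)
qed

lemma frenet_system_first:
  "frenet_system n I \<epsilon> k x \<Longrightarrow> s \<in> I \<Longrightarrow> (x 1 has_real_derivative k 1 s * x 2 s) (at s)"
  by (simp add: frenet_system_def)

lemma frenet_system_last:
  "frenet_system n I \<epsilon> k x \<Longrightarrow> s \<in> I \<Longrightarrow> (x n has_real_derivative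
    - (\<epsilon> (n - 2) * \<epsilon> (n - 1) * k (n - 1) s) * x (n - 1) s) (at s)"
  by (simp add: frenet_system_def)

lemma frenet_system_middle:
  assumes "frenet_system n I \<epsilon> k x" and "s \<in> I" and "0 < i" and "i + 1 < n"
  shows "(x (i + 1) has_real_derivative
    - (\<epsilon> (i - 1) * \<epsilon> i * k i s) * x i s + k (i + 1) s * x (i + 2) s) (at s)"
  using assms unfolding frenet_system_def
  by (auto dest!: bspec[of I _ s] spec[of _ "i + 1"] simp: numeral_2_eq_2)

lemma frenet_system_harmonic:
  assumes sys: "frenet_system n I \<epsilon> k x" and xn: "\<And>s. s \<in> I \<Longrightarrow> x n s = r" and "r \<noteq> 0"
  shows "i \<le> n - 2 \<Longrightarrow> s \<in> I \<Longrightarrow> x (n - 1 - i) s = r * H i s"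
proof (induction i arbitrary: s rule: less_induct)
  case (less i)
  have last: "x (n - 1) t = 0" if "t \<in> I" for t
  proof -
    have "- (\<epsilon> (n - 2) * \<epsilon> (n - 1) * k (n - 1) t) * x (n - 1) t = 0"
      by (rule has_real_derivative_const_on[OF open_I that xn frenet_system_last[OF sys that]])
    then show ?thesis
      using k_pos[OF that, of "n - 1"] sign_nonzero[of "n - 1"] sign_nonzero[of "n - 2"] n3
      by (simp add: le_diff_conv2)
  qed
  consider "i = 0" | "i = 1" | j where "i = j + 2"
    by (metis One_nat_def Suc_eq_plus1 add_2_eq_Suc' not0_implies_Suc)
  then show ?case
  proof cases
    case 1
    then show ?thesis using last less.prems by simp
  next
    case 2
    have "(x (n - 1) has_real_derivative
        - (\<epsilon> (n - 3) * \<epsilon> (n - 2) * k (n - 2) s) * x (n - 2) s + k (n - 1) s * x n s) (at s)"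
      using frenet_system_middle[OF sys \<open>s \<in> I\<close>, of "n - 2"] n3
      by (simp add: numeral_2_eq_2 numeral_3_eq_3 Suc_diff_Suc)
    from has_real_derivative_const_on[OF open_I \<open>s \<in> I\<close> last this]
    have "0 = - (\<epsilon> (n - 3) * \<epsilon> (n - 2) * k (n - 2) s) * x (n - 2) s + k (n - 1) s * x n s"
      by (rule sym)
    then have "x (n - 2) s = (k (n - 1) s * x n s - 0) * (\<epsilon> (n - 3) * \<epsilon> (n - 2) / k (n - 2) s)"
      using n3 by (intro sign_solve k_pos \<open>s \<in> I\<close>) auto
    then show ?thesis
      using 2 xn[OF \<open>s \<in> I\<close>] by (simp add: numeral_2_eq_2)
  next
    case (3 j)
    have n: "n \<ge> j + 4" using 3 less.prems n3 by simp
    define m where "m = n - (j + 3)"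
    have m: "n = m + (j + 3)" "0 < m" using n by (auto simp: m_def)
    have H1: "x (m + 1) t = r * H (j + 1) t" if "t \<in> I" for t
      using less.IH[of "j + 1" t] 3 less.prems that m by (simp add: add.commute)
    have H0: "x (m + 2) s = r * H j s"
      using less.IH[of j s] 3 less.prems m by (simp add: add.commute)
    let ?d = "- (\<epsilon> (m - 1) * \<epsilon> m * k m s) * x m s + k (m + 1) s * x (m + 2) s"
    have "(x (m + 1) has_real_derivative ?d) (at s)"
      using m by (intro frenet_system_middle sys \<open>s \<in> I\<close>) auto
    then have "((\<lambda>t. x (m + 1) t / r) has_real_derivative ?d / r) (at s)"
      by (rule DERIV_cdivide)
    then have "(H (j + 1) has_real_derivative ?d / r) (at s)"
      by (rule has_real_derivative_congI[OF open_I \<open>s \<in> I\<close>, rotated]) (simp add: H1[simplified] \<open>r \<noteq> 0\<close>)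
    then have "deriv (H (j + 1)) s = ?d / r"
      by (rule DERIV_imp_deriv)
    then have "r * deriv (H (j + 1)) s = ?d"
      using \<open>r \<noteq> 0\<close> by (simp only: nonzero_mult_div_cancel_left times_divide_eq_right not_False_eq_True)
    then have "x m s = (k (m + 1) s * x (m + 2) s - r * deriv (H (j + 1)) s)
        * (\<epsilon> (m - 1) * \<epsilon> m / k m s)"
      using m by (intro sign_solve k_pos \<open>s \<in> I\<close>) auto
    also have "\<dots> = r * H i s"
    proof -
      have e: "n - (j + 2) = m + 1" "n - (j + 3) = m" "n - (j + 4) = m - 1" "i = Suc (Suc j)"
        using 3 m by auto
      show ?thesis
        unfolding H0 e(4) harmonic_curvature.simps(3) e(1-3) unfolding Suc_eq_plus1
        by (simp only: algebra_simps)
    qed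
    finally show ?thesis using m 3 by simp
  qed
qed

lemma frenet_system_zero:
  assumes sys: "frenet_system n I \<epsilon> k x" and x1: "\<And>s. s \<in> I \<Longrightarrow> x 1 s = 0"
  shows "1 \<le> i \<Longrightarrow> i \<le> n \<Longrightarrow> s \<in> I \<Longrightarrow> x i s = 0"
proof (induction i arbitrary: s rule: less_induct)
  case (less i)
  consider "i = 1" | "i = 2" | j where "i = j + 2" "0 < j"
    using less.prems by (metis One_nat_def Suc_eq_plus1 add_2_eq_Suc' not0_implies_Suc not_gr0
        numeral_2_eq_2 not_one_le_zero)
  then show ?case
  proof cases
    case 1
    then show ?thesis using x1 less.prems by simp
  next
    case 2
    have "k 1 s * x 2 s = 0"
      by (rule has_real_derivative_const_on[OF open_I \<open>s \<in> I\<close> x1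
          frenet_system_first[OF sys \<open>s \<in> I\<close>]])
    then show ?thesis using k_pos[of s 1] n3 2 less.prems by simp
  next
    case (3 j)
    have zero: "x (j + 1) t = 0" if "t \<in> I" for t
      using less.IH[of "j + 1" t] 3 less.prems that by simp
    have "(x (j + 1) has_real_derivative
        - (\<epsilon> (j - 1) * \<epsilon> j * k j s) * x j s + k (j + 1) s * x (j + 2) s) (at s)"
      using 3 less.prems by (intro frenet_system_middle sys) auto
    from has_real_derivative_const_on[OF open_I \<open>s \<in> I\<close> zero this]
    have "k (j + 1) s * x (j + 2) s = 0"
      using less.IH[of j s] 3 less.prems by simp
    then show ?thesis using k_pos[of s "j + 1"] 3 less.prems by simp
  qed
qed

lemma frenet_system_imp_harmonic_condition:
  assumes sys: "frenet_system n I \<epsilon> k x" and xn: "\<And>s. s \<in> I \<Longrightarrow> x n s = r" and "r \<noteq> 0"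
    and "I \<noteq> {}"
  shows "\<forall>s\<in>I. deriv (H (n - 2)) s = k 1 s * H (n - 3) s" and "\<exists>s\<in>I. H (n - 2) s \<noteq> 0"
proof -
  have x1: "x 1 s = r * H (n - 2) s" if "s \<in> I" for s
    using frenet_system_harmonic[OF sys xn \<open>r \<noteq> 0\<close>, of "n - 2" s] that n3
    by (simp add: Suc_diff_Suc numeral_2_eq_2)
  have x2: "x 2 s = r * H (n - 3) s" if "s \<in> I" for s
  proof -
    have "n - 1 - (n - 3) = 2" "n - 3 \<le> n - 2" using n3 by auto
    then show ?thesis
      using frenet_system_harmonic[OF sys xn \<open>r \<noteq> 0\<close>, of "n - 3" s] that by simp
  qed
  show "\<forall>s\<in>I. deriv (H (n - 2)) s = k 1 s * H (n - 3) s"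
  proof
    fix s assume "s \<in> I"
    have "(x 1 has_real_derivative k 1 s * x 2 s) (at s)"
      by (rule frenet_system_first[OF sys \<open>s \<in> I\<close>])
    then have "((\<lambda>t. x 1 t / r) has_real_derivative k 1 s * x 2 s / r) (at s)"
      by (rule DERIV_cdivide)
    then have "(H (n - 2) has_real_derivative k 1 s * x 2 s / r) (at s)"
      by (rule has_real_derivative_congI[OF open_I \<open>s \<in> I\<close>, rotated]) (simp add: x1[unfolded One_nat_def] \<open>r \<noteq> 0\<close>)
    then show "deriv (H (n - 2)) s = k 1 s * H (n - 3) s"
      using x2[OF \<open>s \<in> I\<close>] \<open>r \<noteq> 0\<close> by (simp add: DERIV_imp_deriv)
  qed
  show "\<exists>s\<in>I. H (n - 2) s \<noteq> 0"
  proof (rule ccontr)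
    assume "\<not> ?thesis"
    then have "x 1 s = 0" if "s \<in> I" for s
      using x1[OF that] that by simp
    from frenet_system_zero[OF sys this, of n]
    have "x n s = 0" if "s \<in> I" for s
      using that n3 by simp
    then show False using xn \<open>r \<noteq> 0\<close> \<open>I \<noteq> {}\<close> by auto
  qed
qed

lemma smooth_on_harmonic_curvature:
  assumes k: "\<And>i. 1 \<le> i \<Longrightarrow> i < n \<Longrightarrow> smooth_on I (k i)"
  shows "i \<le> n - 2 \<Longrightarrow> smooth_on I (H i)"
proof (induction i rule: less_induct)
  case (less i)
  have nz: "k j s \<noteq> 0" if "s \<in> I" "1 \<le> j" "j < n" for j s
    using k_pos[OF that] by simp
  consider "i = 0" | "i = 1" | j where "i = j + 2"
    by (metis One_nat_def Suc_eq_plus1 add_2_eq_Suc' not0_implies_Suc)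
  then show ?case
  proof cases
    case 1
    then show ?thesis by (simp add: smooth_on_const open_I)
  next
    case 2
    have "smooth_on I (\<lambda>s. \<epsilon> (n - 3) * \<epsilon> (n - 2) * (k (n - 1) s / k (n - 2) s))"
      using n3 by (intro smooth_on_mult smooth_on_const smooth_on_divide k open_I nz) auto
    then show ?thesis using 2 by simp
  next
    case (3 j)
    have "smooth_on I (H j)" "smooth_on I (H (Suc j))"
      using less 3 by auto
    then have "smooth_on I (\<lambda>s. (k (n - (j + 2)) s * H j s - deriv (H (Suc j)) s)
        * (\<epsilon> (n - (j + 4)) * \<epsilon> (n - (j + 3)) / k (n - (j + 3)) s))"
      using n3 3 less.prems
      by (intro smooth_on_mult smooth_on_diff smooth_on_deriv smooth_on_const smooth_on_divide
          k open_I nz) auto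
    then show ?thesis using 3 by (simp del: One_nat_def)
  qed
qed

lemma harmonic_condition_imp_frenet_system:
  assumes smooth: "\<And>i. i \<le> n - 2 \<Longrightarrow> smooth_on I (H i)"
    and cond: "\<forall>s\<in>I. deriv (H (n - 2)) s = k 1 s * H (n - 3) s"
  shows "frenet_system n I \<epsilon> k (\<lambda>i. if i = n then (\<lambda>_. 1) else H (n - 1 - i))"
    (is "frenet_system n I \<epsilon> k ?x")
proof -
  have D: "(H i has_real_derivative deriv (H i) s) (at s)" if "i \<le> n - 2" "s \<in> I" for i s
    using smooth_on_has_field_derivative[OF smooth] that by blast
  have first: "(?x 1 has_real_derivative k 1 s * ?x 2 s) (at s)" if s: "s \<in> I" for s
  proof -
    have "n - 1 - 1 = n - 2" "n - 1 - 2 = n - 3" "n \<noteq> 1" "n \<noteq> 2" using n3 by auto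
    then show ?thesis using D[of "n - 2" s] s cond by auto
  qed
  have middle: "(?x i has_real_derivative
      - (\<epsilon> (i - 2) * \<epsilon> (i - 1) * k (i - 1) s) * ?x (i - 1) s + k i s * ?x (i + 1) s) (at s)"
    if s: "s \<in> I" and i: "1 < i" "i < n" for i s
  proof -
    have kp: "k (i - 1) s > 0" using k_pos s i by simp
    have ee: "\<epsilon> (i - 2) * \<epsilon> (i - 1) * (\<epsilon> (i - 2) * \<epsilon> (i - 1)) = 1"
      using sign_sq[of "i - 2"] sign_sq[of "i - 1"] i by (simp add: mult_ac)
    have cancel: "\<epsilon> (i - 2) * \<epsilon> (i - 1) * k (i - 1) s * (y * (\<epsilon> (i - 2) * \<epsilon> (i - 1) / k (i - 1) s))
        = y" for y
    proof -
      have "\<epsilon> (i - 2) * \<epsilon> (i - 1) * k (i - 1) s * (y * (\<epsilon> (i - 2) * \<epsilon> (i - 1) / k (i - 1) s))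
        = \<epsilon> (i - 2) * \<epsilon> (i - 1) * (\<epsilon> (i - 2) * \<epsilon> (i - 1)) * y * (k (i - 1) s / k (i - 1) s)"
        by (simp only: times_divide_eq_right times_divide_eq_left mult_ac)
      then show ?thesis using ee kp by simp
    qed
    show ?thesis
    proof (cases "i = n - 1")
      case True
      have e: "n - 1 - (i - 1) = Suc 0" "i - 1 \<noteq> n" "i \<noteq> n" "i + 1 = n" "n - 2 = i - 1" "n - 3 = i - 2"
        "n - 1 = i"
        using True i n3 by auto
      have "?x i = (\<lambda>_. 0)" unfolding if_not_P[OF e(3)] using e by simp
      moreover have "?x (i - 1) s = k i s * (\<epsilon> (i - 2) * \<epsilon> (i - 1) / k (i - 1) s)"
        unfolding if_not_P[OF e(2)] e(1) by (simp add: e[unfolded One_nat_def])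
      ultimately show ?thesis using cancel[of "k i s"] e(4) by simp
    next
      case False
      define j where "j = n - 2 - i"
      have j: "n - 1 - (i - 1) = Suc (Suc j)" "n - 1 - i = Suc j" "n - 1 - (i + 1) = j"
        "i - 1 \<noteq> n" "i \<noteq> n" "i + 1 \<noteq> n" "n - (j + 2) = i" "n - (j + 3) = i - 1"
        "n - (j + 4) = i - 2" "Suc j \<le> n - 2"
        using False i n3 by (auto simp: j_def)
      have x0: "?x (i - 1) s = (k i s * H j s - deriv (H (Suc j)) s)
          * (\<epsilon> (i - 2) * \<epsilon> (i - 1) / k (i - 1) s)"
        unfolding if_not_P[OF j(4)] j(1) harmonic_curvature.simps(3) j(7,8,9) ..
      have x1: "?x i = H (Suc j)" and x2: "?x (i + 1) = H j"
        by (simp_all only: if_not_P[OF j(5)] if_not_P[OF j(6)] j(2,3))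
      show ?thesis
        unfolding x0 x1 x2 mult_minus_left cancel
        using D[OF j(10) s] by (simp only: minus_diff_eq diff_add_cancel)
    qed
  qed
  have last: "(?x n has_real_derivative - (\<epsilon> (n - 2) * \<epsilon> (n - 1) * k (n - 1) s) * ?x (n - 1) s) (at s)"
    for s
  proof -
    have "?x (n - 1) s = 0" using n3 by simp
    then show ?thesis by simp
  qed
  show ?thesis
    unfolding frenet_system_def using first middle last by blast
qed

end

section \<open>Coordinate fields\<close>

lemma sum_apply: "(\<Sum>i\<in>J. f i) x = (\<Sum>i\<in>J. f i x)"
  by (induction J rule: infinite_finite_induct) (simp_all add: plus_fun_def zero_fun_def)

lemmas tvec_apply = plus_fun_def zero_fun_def scaleR_fun_def sum_apply

context smooth_manifold
begin

lemma chart_dom_openin: "c \<in> A \<Longrightarrow> openin M (chart_dom c)"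
  using charts[of c] by (simp add: is_chart_def)

lemma chart_map_inj: "c \<in> A \<Longrightarrow> inj_on (chart_map c) (chart_dom c)"
proof -
  assume c: "c \<in> A"
  have "topspace M \<inter> chart_dom c = chart_dom c"
    using openin_subset[OF chart_dom_openin[OF c]] by blast
  then show ?thesis
    using charts[OF c] homeomorphic_imp_injective_map unfolding is_chart_def
    by (metis topspace_subtopology)
qed

lemma chart_inv_chart_map: "c \<in> A \<Longrightarrow> p \<in> chart_dom c \<Longrightarrow> chart_inv c (chart_map c p) = p"
  unfolding chart_inv_def by (rule inv_into_f_f[OF chart_map_inj])

lemma transition_chart_map:
  "c \<in> A \<Longrightarrow> p \<in> chart_dom c \<Longrightarrow> transition c d (chart_map c p) = chart_map d p"
  by (simp add: transition_def chart_inv_chart_map)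

lemma open_chart_image:
  assumes c: "c \<in> A" and W: "openin M W"
  shows "open (chart_map c ` (chart_dom c \<inter> W))"
proof -
  have hom: "homeomorphic_map (subtopology M (chart_dom c))
      (top_of_set (chart_map c ` chart_dom c)) (chart_map c)"
    and op: "open (chart_map c ` chart_dom c)"
    using charts[OF c] by (simp_all add: is_chart_def)
  have "openin (subtopology M (chart_dom c)) (chart_dom c \<inter> W)"
    using W by (rule openin_subtopology_Int2)
  then have "openin (top_of_set (chart_map c ` chart_dom c)) (chart_map c ` (chart_dom c \<inter> W))"
    using homeomorphic_imp_open_map[OF hom] by (simp add: open_map_def)
  then show ?thesis
    using op openin_open_trans by blast
qed

lemma transition_has_derivative:
  assumes "c \<in> A" and "d \<in> A" and "p \<in> chart_dom c" and "p \<in> chart_dom d"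
  shows "(transition c d has_derivative frechet_derivative (transition c d) (at (chart_map c p)))
    (at (chart_map c p))"
  using assms by (intro smooth_on_has_derivative[OF smooth_transition]) auto

lemma linear_transition_derivative:
  assumes "c \<in> A" and "d \<in> A" and "p \<in> chart_dom c" and "p \<in> chart_dom d"
  shows "linear (frechet_derivative (transition c d) (at (chart_map c p)))"
  using transition_has_derivative[OF assms] by (rule has_derivative_linear)

lemma transition_derivative_compose:
  assumes A: "c \<in> A" "d \<in> A" "e \<in> A"
    and p: "p \<in> chart_dom c" "p \<in> chart_dom d" "p \<in> chart_dom e"
  shows "frechet_derivative (transition c e) (at (chart_map c p)) w
    = frechet_derivative (transition d e) (at (chart_map d p))
        (frechet_derivative (transition c d) (at (chart_map c p)) w)"
proof -
  let ?U = "chart_map c ` (chart_dom c \<inter> (chart_dom d \<inter> chart_dom e))"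
  have D: "(transition d e has_derivative frechet_derivative (transition d e) (at (chart_map d p)))
      (at (transition c d (chart_map c p)))"
    using transition_has_derivative[of d e p] A p by (simp add: transition_chart_map)
  have "(transition c e has_derivative
      (\<lambda>w. frechet_derivative (transition d e) (at (chart_map d p))
        (frechet_derivative (transition c d) (at (chart_map c p)) w))) (at (chart_map c p))"
  proof (rule has_derivative_transform_within_open)
    show "((\<lambda>x. transition d e (transition c d x)) has_derivative
      (\<lambda>w. frechet_derivative (transition d e) (at (chart_map d p))
        (frechet_derivative (transition c d) (at (chart_map c p)) w))) (at (chart_map c p))"
      by (rule has_derivative_compose[OF transition_has_derivative[OF A(1,2) p(1,2)] D])
    show "open ?U"
      using A by (intro open_chart_image openin_Int chart_dom_openin)
    show "chart_map c p \<in> ?U"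
      using p by blast
    show "transition d e (transition c d x) = transition c e x" if "x \<in> ?U" for x
      using that A by (auto simp: transition_chart_map)
  qed
  from frechet_derivative_at[OF this] show ?thesis
    by (rule fun_cong[symmetric])
qed

lemma transition_derivative_self:
  assumes c: "c \<in> A" and p: "p \<in> chart_dom c"
  shows "frechet_derivative (transition c c) (at (chart_map c p)) w = w"
proof -
  have "(transition c c has_derivative (\<lambda>w. w)) (at (chart_map c p))"
  proof (rule has_derivative_transform_within_open[OF has_derivative_ident])
    show "open (chart_map c ` (chart_dom c \<inter> chart_dom c))"
      using c by (intro open_chart_image chart_dom_openin)
  qed (use c p in \<open>auto simp: transition_chart_map\<close>)
  from frechet_derivative_at[OF this] show ?thesis
    by (rule fun_cong[symmetric])
qed

lemma tangent_space_transition: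
  assumes "v \<in> tangent_space A p" and "c \<in> A" and "d \<in> A" and "p \<in> chart_dom c" and "p \<in> chart_dom d"
  shows "v d = frechet_derivative (transition c d) (at (chart_map c p)) (v c)"
  using assms unfolding tangent_space_def by blast

lemma tangent_space_off:
  "v \<in> tangent_space A p \<Longrightarrow> c \<notin> A \<or> p \<notin> chart_dom c \<Longrightarrow> v c = 0"
  unfolding tangent_space_def by blast

lemma tangent_space_eqI:
  assumes v: "v \<in> tangent_space A p" and w: "w \<in> tangent_space A p"
    and c: "c \<in> A" "p \<in> chart_dom c" and eq: "v c = w c"
  shows "v = w"
proof
  fix d
  show "v d = w d"
  proof (cases "d \<in> A \<and> p \<in> chart_dom d")
    case True
    then show ?thesis
      using tangent_space_transition[OF v c(1) _ c(2)] tangent_space_transition[OF w c(1) _ c(2)] eq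
      by metis
  next
    case False
    then show ?thesis
      using tangent_space_off[OF v] tangent_space_off[OF w] by simp
  qed
qed

lemma tangent_space_zero: "0 \<in> tangent_space A p"
  unfolding tangent_space_def
  by (auto simp: tvec_apply linear_0[OF linear_transition_derivative])

lemma tangent_space_add:
  assumes "v \<in> tangent_space A p" and "w \<in> tangent_space A p"
  shows "v + w \<in> tangent_space A p"
  unfolding tangent_space_def mem_Collect_eq
proof (intro conjI allI ballI impI)
  show "(v + w) c = 0" if "c \<notin> A \<or> p \<notin> chart_dom c" for c
    using assms that by (simp add: tvec_apply tangent_space_off)
  show "(v + w) d = frechet_derivative (transition c d) (at (chart_map c p)) ((v + w) c)"
    if "c \<in> A" "d \<in> A" "p \<in> chart_dom c \<and> p \<in> chart_dom d" for c d
    using that tangent_space_transition[OF assms(1), of c d] tangent_space_transition[OF assms(2), of c d]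
    by (simp add: tvec_apply linear_add[OF linear_transition_derivative])
qed

lemma tangent_space_scaleR:
  assumes "v \<in> tangent_space A p"
  shows "r *\<^sub>R v \<in> tangent_space A p"
  unfolding tangent_space_def mem_Collect_eq
proof (intro conjI allI ballI impI)
  show "(r *\<^sub>R v) c = 0" if "c \<notin> A \<or> p \<notin> chart_dom c" for c
    using assms that by (simp add: tvec_apply tangent_space_off)
  show "(r *\<^sub>R v) d = frechet_derivative (transition c d) (at (chart_map c p)) ((r *\<^sub>R v) c)"
    if "c \<in> A" "d \<in> A" "p \<in> chart_dom c \<and> p \<in> chart_dom d" for c d
    using that tangent_space_transition[OF assms, of c d]
    by (simp add: tvec_apply linear_scale[OF linear_transition_derivative])
qed

lemma tangent_space_sum:
  "(\<And>i. i \<in> J \<Longrightarrow> v i \<in> tangent_space A p) \<Longrightarrow> (\<Sum>i\<in>J. v i) \<in> tangent_space A p"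
  by (induction J rule: infinite_finite_induct) (auto intro: tangent_space_zero tangent_space_add)

lemma coord_field_self: "c \<in> A \<Longrightarrow> p \<in> chart_dom c \<Longrightarrow> coord_field A c w p c = w"
  by (simp add: coord_field_def transition_derivative_self)

lemma coord_field_tangent:
  "c \<in> A \<Longrightarrow> p \<in> chart_dom c \<Longrightarrow> coord_field A c w p \<in> tangent_space A p"
  unfolding tangent_space_def coord_field_def
  by (auto intro: transition_derivative_compose)

lemma tangent_eq_coord_field:
  assumes "v \<in> tangent_space A p" and "c \<in> A" and "p \<in> chart_dom c"
  shows "coord_field A c (v c) p = v"
  using assms by (intro tangent_space_eqI[of _ p _ c] coord_field_tangent) (auto simp: coord_field_self)

lemma coord_field_add:
  "c \<in> A \<Longrightarrow> coord_field A c (u + v) p = coord_field A c u p + coord_field A c v p"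
  by (auto simp: coord_field_def fun_eq_iff tvec_apply linear_add[OF linear_transition_derivative])

lemma coord_field_scaleR:
  "c \<in> A \<Longrightarrow> coord_field A c (r *\<^sub>R u) p = r *\<^sub>R coord_field A c u p"
  by (auto simp: coord_field_def fun_eq_iff tvec_apply linear_scale[OF linear_transition_derivative])

lemma vector_field_on_coord_field:
  assumes c: "c \<in> A"
  shows "vector_field_on A (chart_dom c) (coord_field A c w)"
  unfolding vector_field_on_def
proof (intro conjI ballI)
  show "coord_field A c w p \<in> tangent_space A p" if "p \<in> chart_dom c" for p
    using c that by (rule coord_field_tangent)
  fix d assume d: "d \<in> A"
  let ?S = "chart_map d ` (chart_dom d \<inter> chart_dom c)"
  let ?T = "chart_map c ` (chart_dom c \<inter> chart_dom d)"
  have op: "open ?S" "open ?T"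
    using c d by (auto intro: open_chart_image chart_dom_openin)
  show "smooth_on ?S (\<lambda>x. coord_field A c w (chart_inv d x) d)"
  proof (rule smooth_on_cong[OF op(1)])
    show "smooth_on ?S (\<lambda>x. frechet_derivative (transition c d) (at (transition d c x)) w)"
      by (rule smooth_on_compose[OF op _ smooth_transition[OF d c]
            smooth_on_frechet_derivative[OF smooth_transition[OF c d]]])
        (auto simp: transition_chart_map d)
    show "frechet_derivative (transition c d) (at (transition d c x)) w
        = coord_field A c w (chart_inv d x) d" if "x \<in> ?S" for x
      using that c d by (auto simp: coord_field_def chart_inv_chart_map transition_chart_map)
  qed
qed

end

section \<open>Fields along a curve\<close>

locale curve_in_manifold = smooth_manifold M A
  for M :: "'a topology" and A :: "('a, 'e::euclidean_space) chart set" +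
  fixes I :: "real set" and \<alpha> :: "real \<Rightarrow> 'a"
  assumes open_domain: "open I" and smooth_curve: "smooth_curve M A I \<alpha>"
begin

abbreviation chart_time :: "('a, 'e) chart \<Rightarrow> real set"
  where "chart_time c \<equiv> {s\<in>I. \<alpha> s \<in> chart_dom c}"

lemma curve_in_topspace: "s \<in> I \<Longrightarrow> \<alpha> s \<in> topspace M"
  using smooth_curve continuous_map_funspace by (fastforce simp: smooth_curve_def)

lemma chart_around: "s \<in> I \<Longrightarrow> \<exists>c\<in>A. \<alpha> s \<in> chart_dom c"
  using curve_in_topspace charts_cover by blast

lemma open_chart_time:
  assumes "c \<in> A"
  shows "open (chart_time c)"
proof -
  have "openin (top_of_set I) {s \<in> topspace (top_of_set I). \<alpha> s \<in> chart_dom c}"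
    using smooth_curve chart_dom_openin[OF assms] unfolding smooth_curve_def
    by (blast intro: openin_continuous_map_preimage)
  then show ?thesis
    using open_domain by (simp add: openin_open_trans)
qed

lemma smooth_on_along_chart:
  assumes c: "c \<in> A" and F: "smooth_on (chart_map c ` (chart_dom c \<inter> chart_dom c)) F"
  shows "smooth_on (chart_time c) (\<lambda>s. F (chart_map c (\<alpha> s)))"
proof (rule smooth_on_compose[OF open_chart_time[OF c] _ _ _ F])
  show "open (chart_map c ` (chart_dom c \<inter> chart_dom c))"
    using c by (intro open_chart_image chart_dom_openin)
  show "smooth_on (chart_time c) (\<lambda>s. chart_map c (\<alpha> s))"
    using smooth_curve c by (simp add: smooth_curve_def)
qed auto

lemma vector_field_along_tangent:
  "vector_field_along A I \<alpha> X \<Longrightarrow> s \<in> I \<Longrightarrow> X s \<in> tangent_space A (\<alpha> s)"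
  by (simp add: vector_field_along_def)

lemma vector_field_along_smooth:
  "vector_field_along A I \<alpha> X \<Longrightarrow> c \<in> A \<Longrightarrow> smooth_on (chart_time c) (\<lambda>s. X s c)"
  by (simp add: vector_field_along_def)

lemma vector_field_along_cong:
  assumes X: "vector_field_along A I \<alpha> X" and eq: "\<And>s. s \<in> I \<Longrightarrow> X s = Y s"
  shows "vector_field_along A I \<alpha> Y"
  unfolding vector_field_along_def
proof (intro conjI ballI)
  show "Y s \<in> tangent_space A (\<alpha> s)" if "s \<in> I" for s
    using vector_field_along_tangent[OF X that] eq[OF that] by simp
  show "smooth_on (chart_time c) (\<lambda>s. Y s c)" if "c \<in> A" for c
    by (rule smooth_on_cong[OF open_chart_time[OF that] _ vector_field_along_smooth[OF X that]])
       (simp add: eq)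
qed

lemma vector_field_along_combination:
  assumes a: "\<And>i. i \<in> J \<Longrightarrow> smooth_on I (a i)"
    and X: "\<And>i. i \<in> J \<Longrightarrow> vector_field_along A I \<alpha> (X i)"
  shows "vector_field_along A I \<alpha> (\<lambda>s. \<Sum>i\<in>J. a i s *\<^sub>R X i s)"
  unfolding vector_field_along_def
proof (intro conjI ballI)
  show "(\<Sum>i\<in>J. a i s *\<^sub>R X i s) \<in> tangent_space A (\<alpha> s)" if "s \<in> I" for s
    using X that by (intro tangent_space_sum tangent_space_scaleR vector_field_along_tangent)
  show "smooth_on (chart_time c) (\<lambda>s. (\<Sum>i\<in>J. a i s *\<^sub>R X i s) c)" if "c \<in> A" for c
    unfolding tvec_apply using a X that
    by (intro smooth_on_sum smooth_on_scaleR open_chart_time vector_field_along_smooth)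
       (auto intro: smooth_on_subset)
qed

end

locale curve_in_pseudo_riemannian = curve_in_manifold M A I \<alpha> + pseudo_riemannian_manifold M A g
  for M :: "'a topology" and A :: "('a, 'e::euclidean_space) chart set" and I \<alpha> g
begin

lemma smooth_on_metric:
  assumes X: "vector_field_along A I \<alpha> X" and Y: "vector_field_along A I \<alpha> Y"
  shows "smooth_on I (\<lambda>s. g (\<alpha> s) (X s) (Y s))"
proof (rule smooth_on_local)
  fix t assume "t \<in> I"
  then obtain c where c: "c \<in> A" "\<alpha> t \<in> chart_dom c"
    using chart_around by blast
  define B where "B s u v = g (\<alpha> s) (coord_field A c u (\<alpha> s)) (coord_field A c v (\<alpha> s))" for s u v
  have "smooth_on (chart_time c) (\<lambda>s. B s (X s c) (Y s c))"
  proof (rule smooth_on_bilinear_family[where B=B, OF open_chart_time[OF c(1)]])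
    fix s assume s: "s \<in> chart_time c"
    have T: "coord_field A c u (\<alpha> s) \<in> tangent_space A (\<alpha> s)" for u
      using c s by (auto intro: coord_field_tangent)
    have M: "\<alpha> s \<in> topspace M"
      using s curve_in_topspace by blast
    show "bilinear (B s)"
      unfolding bilinear_def
    proof (intro conjI allI linearI)
      show add: "B s (u + u') v = B s u v + B s u' v" for u u' v
        unfolding B_def coord_field_add[OF c(1)] by (rule metric_add_left[OF M T T T])
      show scale: "B s (r *\<^sub>R u) v = r *\<^sub>R B s u v" for r u v
        unfolding B_def coord_field_scaleR[OF c(1)] real_scaleR_def by (rule metric_scale_left[OF M T T])
      have sym: "B s u v = B s v u" for u v
        unfolding B_def by (rule metric_sym[OF M T T])
      show "B s u (v + v') = B s u v + B s u v'" for u v v'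
        unfolding sym[of u] by (rule add)
      show "B s u (r *\<^sub>R v) = r *\<^sub>R B s u v" for r u v
        unfolding sym[of u] by (rule scale)
    qed
  next
    fix b d
    have "smooth_function A (chart_dom c) (\<lambda>p. g p (coord_field A c b p) (coord_field A c d p))"
      using c(1) by (intro metric_smooth vector_field_on_coord_field chart_dom_openin)
    then have "smooth_on (chart_map c ` (chart_dom c \<inter> chart_dom c))
        ((\<lambda>p. g p (coord_field A c b p) (coord_field A c d p)) \<circ> chart_inv c)"
      using c(1) unfolding smooth_function_def by (rule bspec)
    from smooth_on_along_chart[OF c(1) this] show "smooth_on (chart_time c) (\<lambda>s. B s b d)"
      by (rule smooth_on_cong[OF open_chart_time[OF c(1)], rotated])
         (use c(1) in \<open>simp add: B_def chart_inv_chart_map\<close>)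
  qed (use X Y c(1) in \<open>auto intro: vector_field_along_smooth\<close>)
  then have "smooth_on (chart_time c) (\<lambda>s. g (\<alpha> s) (X s) (Y s))"
    by (rule smooth_on_cong[OF open_chart_time[OF c(1)], rotated])
       (use c(1) X Y in \<open>simp add: B_def tangent_eq_coord_field vector_field_along_tangent\<close>)
  with open_chart_time[OF c(1)] \<open>t \<in> I\<close> c(2)
  show "\<exists>U. open U \<and> t \<in> U \<and> smooth_on U (\<lambda>s. g (\<alpha> s) (X s) (Y s))"
    by blast
qed

end

context affine_connection
begin

lemma linear_nabla_coord_field:
  assumes c: "c \<in> A" "p \<in> chart_dom c" and v: "v \<in> tangent_space A p"
  shows "linear (\<lambda>w. nabla p v (coord_field A c w))"
proof (rule linearI)
  note F = chart_dom_openin[OF c(1)] c(2) v vector_field_on_coord_field[OF c(1)]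
  fix u w and r :: real
  have "coord_field A c (u + w) = (\<lambda>q. coord_field A c u q + coord_field A c w q)"
    by (rule ext) (rule coord_field_add[OF c(1)])
  then show "nabla p v (coord_field A c (u + w))
      = nabla p v (coord_field A c u) + nabla p v (coord_field A c w)"
    by (simp only: nabla_add_right[OF F vector_field_on_coord_field[OF c(1)]])
  have "smooth_function A (chart_dom c) (\<lambda>_. r)"
    using chart_dom_openin[OF c(1)] unfolding smooth_function_def
    by (auto simp: comp_def intro!: smooth_on_const open_chart_image)
  from nabla_Leibniz[OF F this c]
  have "nabla p v (\<lambda>q. r *\<^sub>R coord_field A c u q) = r *\<^sub>R nabla p v (coord_field A c u)"
    by (simp add: dir_deriv_def comp_def)
  moreover have "coord_field A c (r *\<^sub>R u) = (\<lambda>q. r *\<^sub>R coord_field A c u q)"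
    by (rule ext) (rule coord_field_scaleR[OF c(1)])
  ultimately show "nabla p v (coord_field A c (r *\<^sub>R u)) = r *\<^sub>R nabla p v (coord_field A c u)"
    by simp
qed

end

locale curve_with_connection = curve_in_manifold M A I \<alpha> + affine_connection M A nabla
  for M :: "'a topology" and A :: "('a, 'e::euclidean_space) chart set" and I \<alpha> nabla +
  assumes velocity_field: "vector_field_along A I \<alpha> (velocity A \<alpha>)"
begin

lemma smooth_on_cov_deriv:
  assumes X: "vector_field_along A I \<alpha> X" and c: "c \<in> A"
  shows "smooth_on (chart_time c) (\<lambda>s. cov_deriv A nabla \<alpha> X s c)"
proof -
  define B where "B s u v = nabla (\<alpha> s) (coord_field A c u (\<alpha> s)) (coord_field A c v) c" for s u v
  have "smooth_on (chart_time c) (\<lambda>s. B s (velocity A \<alpha> s c) (X s c))"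
  proof (rule smooth_on_bilinear_family[where B=B, OF open_chart_time[OF c]])
    fix s assume s: "s \<in> chart_time c"
    have T: "coord_field A c u (\<alpha> s) \<in> tangent_space A (\<alpha> s)" for u
      using c s by (auto intro: coord_field_tangent)
    have as: "\<alpha> s \<in> chart_dom c" using s by blast
    note F = chart_dom_openin[OF c] as
    show "bilinear (B s)"
      unfolding bilinear_def
    proof (intro conjI allI linearI)
      show "B s (u + u') v = B s u v + B s u' v" for u u' v
        unfolding B_def coord_field_add[OF c]
          nabla_add_left[OF F T T vector_field_on_coord_field[OF c]]
        by (simp only: tvec_apply)
      show "B s (r *\<^sub>R u) v = r *\<^sub>R B s u v" for r u v
        unfolding B_def coord_field_scaleR[OF c]
          nabla_scale_left[OF F T vector_field_on_coord_field[OF c]]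
        by (simp only: tvec_apply)
      show "B s u (v + v') = B s u v + B s u v'" for u v v'
        unfolding B_def linear_add[OF linear_nabla_coord_field[OF c as T]] by (simp only: tvec_apply)
      show "B s u (r *\<^sub>R v) = r *\<^sub>R B s u v" for r u v
        unfolding B_def linear_scale[OF linear_nabla_coord_field[OF c as T]] by (simp only: tvec_apply)
    qed
  next
    fix b d
    have "vector_field_on A (chart_dom c) (\<lambda>q. nabla q (coord_field A c b q) (coord_field A c d))"
      using c by (intro nabla_smooth vector_field_on_coord_field chart_dom_openin)
    then have "smooth_on (chart_map c ` (chart_dom c \<inter> chart_dom c))
        (\<lambda>x. nabla (chart_inv c x) (coord_field A c b (chart_inv c x)) (coord_field A c d) c)"
      using c unfolding vector_field_on_def by (rule bspec[OF conjunct2])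
    from smooth_on_along_chart[OF c this] show "smooth_on (chart_time c) (\<lambda>s. B s b d)"
      by (rule smooth_on_cong[OF open_chart_time[OF c], rotated])
         (use c in \<open>simp add: B_def chart_inv_chart_map\<close>)
  qed (use X velocity_field c in \<open>auto intro: vector_field_along_smooth\<close>)
  then have "smooth_on (chart_time c) (\<lambda>s. vector_derivative (\<lambda>t. X t c) (at s)
      + B s (velocity A \<alpha> s c) (X s c))"
    using c
    by (intro smooth_on_add smooth_on_vector_derivative open_chart_time
        vector_field_along_smooth[OF X])
  then show ?thesis
    by (rule smooth_on_cong[OF open_chart_time[OF c], rotated])
       (use c velocity_field in \<open>simp add: B_def cov_deriv_def tangent_eq_coord_field vector_field_along_tangent\<close>)
qed

lemma cov_deriv_combination:
  assumes a: "\<And>i. i \<in> J \<Longrightarrow> smooth_on I (a i)"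
    and X: "\<And>i. i \<in> J \<Longrightarrow> vector_field_along A I \<alpha> (X i)" and s: "s \<in> I"
  shows "cov_deriv A nabla \<alpha> (\<lambda>t. \<Sum>i\<in>J. a i t *\<^sub>R X i t) s
    = (\<Sum>i\<in>J. deriv (a i) s *\<^sub>R X i s + a i s *\<^sub>R cov_deriv A nabla \<alpha> (X i) s)"
proof
  fix c
  show "cov_deriv A nabla \<alpha> (\<lambda>t. \<Sum>i\<in>J. a i t *\<^sub>R X i t) s c
    = (\<Sum>i\<in>J. deriv (a i) s *\<^sub>R X i s + a i s *\<^sub>R cov_deriv A nabla \<alpha> (X i) s) c"
  proof (cases "c \<in> A \<and> \<alpha> s \<in> chart_dom c")
    case True
    let ?N = "\<lambda>w. nabla (\<alpha> s) (velocity A \<alpha> s) (coord_field A c w)"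
    have "((\<lambda>t. \<Sum>i\<in>J. a i t *\<^sub>R X i t c) has_vector_derivative
        (\<Sum>i\<in>J. a i s *\<^sub>R vector_derivative (\<lambda>t. X i t c) (at s) + deriv (a i) s *\<^sub>R X i s c)) (at s)"
    proof (intro has_vector_derivative_sum has_vector_derivative_scaleR)
      fix i assume i: "i \<in> J"
      show "(a i has_real_derivative deriv (a i) s) (at s)"
        by (rule smooth_on_has_field_derivative[OF a[OF i] s])
      show "((\<lambda>t. X i t c) has_vector_derivative vector_derivative (\<lambda>t. X i t c) (at s)) (at s)"
        using True s by (intro smooth_on_has_vector_derivative[OF vector_field_along_smooth[OF X[OF i]]]) auto
    qed
    then have D: "vector_derivative (\<lambda>t. \<Sum>i\<in>J. a i t *\<^sub>R X i t c) (at s)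
        = (\<Sum>i\<in>J. a i s *\<^sub>R vector_derivative (\<lambda>t. X i t c) (at s) + deriv (a i) s *\<^sub>R X i s c)"
      by (rule vector_derivative_at)
    have lin: "linear ?N"
      using True vector_field_along_tangent[OF velocity_field s] by (intro linear_nabla_coord_field) auto
    have N: "?N (\<Sum>i\<in>J. a i s *\<^sub>R X i s c) c = (\<Sum>i\<in>J. a i s *\<^sub>R ?N (X i s c) c)"
      by (simp only: linear_sum[OF lin] linear_scale[OF lin] tvec_apply)
    show ?thesis
      using True by (simp add: cov_deriv_def tvec_apply D N sum.distrib[symmetric] algebra_simps)
  next
    case False
    then have "X i s c = 0" if "i \<in> J" for i
      using tangent_space_off[OF vector_field_along_tangent[OF X[OF that] s]] by blast
    then show ?thesis
      using False by (auto simp: cov_deriv_def tvec_apply)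
  qed
qed

end

section \<open>The Frenet frame\<close>

lemma sum_shift:
  fixes f :: "nat \<Rightarrow> 'b::ab_group_add"
  assumes "f 0 = 0" and "f n = 0"
  shows "(\<Sum>i=1..n. f (i - 1)) = (\<Sum>i=1..n. f i)"
proof -
  have "(\<Sum>i=1..n. f (i - 1)) = (\<Sum>i<n. f i)"
    by (simp add: sum.atLeast1_atMost_eq)
  also have "\<dots> = (\<Sum>i\<le>n. f i)"
    using assms(2) by (simp add: lessThan_Suc_atMost[symmetric])
  also have "\<dots> = (\<Sum>i=1..n. f i)"
    using assms(1) by (simp add: atMost_atLeast0 sum.atLeast_Suc_atMost)
  finally show ?thesis .
qed

lemma (in pseudo_riemannian_manifold) metric_sum_left:
  assumes p: "p \<in> topspace M" and w: "w \<in> tangent_space A p"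
    and v: "\<And>i. i \<in> J \<Longrightarrow> v i \<in> tangent_space A p"
  shows "g p (\<Sum>i\<in>J. a i *\<^sub>R v i) w = (\<Sum>i\<in>J. a i * g p (v i) w)"
proof -
  have zero: "g p 0 w = 0"
    using metric_scale_left[OF p tangent_space_zero w, of 0] by simp
  from v show ?thesis
  proof (induction J rule: infinite_finite_induct)
    case (insert i J)
    have "g p (a i *\<^sub>R v i + (\<Sum>i\<in>J. a i *\<^sub>R v i)) w
        = g p (a i *\<^sub>R v i) w + g p (\<Sum>i\<in>J. a i *\<^sub>R v i) w"
      using insert.prems p w
      by (intro metric_add_left tangent_space_scaleR tangent_space_sum) auto
    also have "g p (a i *\<^sub>R v i) w = a i * g p (v i) w"
      using insert.prems p w by (intro metric_scale_left) auto
    also have "g p (\<Sum>i\<in>J. a i *\<^sub>R v i) w = (\<Sum>i\<in>J. a i * g p (v i) w)"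
      using insert by blast
    finally show ?case
      by (simp only: sum.insert[OF insert.hyps])
  qed (simp_all add: zero)
qed

lemma (in curve_in_manifold) cov_deriv_cong:
  assumes "\<And>t. t \<in> I \<Longrightarrow> X t = Y t" and "s \<in> I"
  shows "cov_deriv A nabla \<alpha> X s = cov_deriv A nabla \<alpha> Y s"
proof -
  have "\<forall>\<^sub>F t in nhds s. X t c = Y t c" for c
    using assms open_domain by (auto simp: eventually_nhds)
  then have "vector_derivative (\<lambda>t. X t c) (at s) = vector_derivative (\<lambda>t. Y t c) (at s)" for c
    by (intro vector_derivative_cong_eq) (auto elim: eventually_mono)
  then show ?thesis
    unfolding cov_deriv_def by (simp only: assms(1)[OF assms(2)])
qed

locale long_proper_curve = proper_curve +
  assumes order_ge_3: "n \<ge> 3"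

sublocale long_proper_curve \<subseteq> curve_in_pseudo_riemannian M A I \<alpha> g
  by unfold_locales (fact interval(1) curve)+

sublocale long_proper_curve \<subseteq> curve_with_connection M A I \<alpha> nabla
proof
  show "vector_field_along A I \<alpha> (velocity A \<alpha>)"
    using order_ge_3 by (intro vector_field_along_cong[OF frame_field tangent]) auto
qed

sublocale long_proper_curve \<subseteq> frenet_data n I \<epsilon> k
proof
  show "\<epsilon> j * \<epsilon> j = 1" if "j < n" for j
    using sign[of "Suc j"] that by auto
qed (use order_ge_3 interval(1) curvature_pos in auto)

context long_proper_curve
begin

lemma frame_tangent: "s \<in> I \<Longrightarrow> 1 \<le> i \<Longrightarrow> i \<le> n \<Longrightarrow> V i s \<in> tangent_space A (\<alpha> s)"
  by (rule vector_field_along_tangent[OF frame_field])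

lemma metric_frame_combination:
  assumes s: "s \<in> I" and j: "1 \<le> j" "j \<le> n"
  shows "g (\<alpha> s) (\<Sum>i=1..n. u i *\<^sub>R V i s) (V j s) = u j * \<epsilon> (j - 1)"
proof -
  have "g (\<alpha> s) (\<Sum>i=1..n. u i *\<^sub>R V i s) (V j s) = (\<Sum>i=1..n. u i * g (\<alpha> s) (V i s) (V j s))"
    using s j by (intro metric_sum_left curve_in_topspace frame_tangent) auto
  also have "\<dots> = (\<Sum>i=1..n. if i = j then u j * \<epsilon> (j - 1) else 0)"
    using s j by (intro sum.cong) (auto simp: frame_orthogonal frame_unit)
  finally show ?thesis
    using j by simp
qed

lemma frame_independent:
  assumes "s \<in> I" and "1 \<le> j" "j \<le> n" and "(\<Sum>i=1..n. u i *\<^sub>R V i s) = 0"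
  shows "u j = 0"
proof -
  have "g (\<alpha> s) 0 (V j s) = 0"
    using metric_scale_left[OF curve_in_topspace[OF assms(1)] tangent_space_zero
        frame_tangent[OF assms(1-3)], of 0] by simp
  then have "u j * \<epsilon> (j - 1) = 0"
    using metric_frame_combination[OF assms(1-3), of u] assms(4) by simp
  moreover have "\<epsilon> (j - 1) \<noteq> 0"
    by (rule sign_nonzero) (use assms in linarith)
  ultimately show ?thesis
    by simp
qed

lemma frame_expansion:
  assumes s: "s \<in> I" and X: "X \<in> tangent_space A (\<alpha> s)"
  shows "X = (\<Sum>i=1..n. (\<epsilon> (i - 1) * g (\<alpha> s) (V i s) X) *\<^sub>R V i s)"
proof -
  obtain c where c: "c \<in> A" "\<alpha> s \<in> chart_dom c"
    using chart_around[OF s] by blast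
  obtain h :: "nat \<Rightarrow> 'b" where h: "bij_betw h {1..n} Basis"
    using finite_same_card_bij[of "{1..n}" "Basis :: 'b set"] order by auto
  have T: "(\<Sum>i=1..n. u i *\<^sub>R V i s) \<in> tangent_space A (\<alpha> s)" for u
    using s by (intro tangent_space_sum tangent_space_scaleR frame_tangent) auto
  define L where "L w = (\<Sum>i=1..n. (w \<bullet> h i) *\<^sub>R V i s c)" for w
  have "linear L"
    unfolding L_def by (intro linearI) (simp_all add: inner_add_left scaleR_add_left sum.distrib scaleR_sum_right)
  moreover have "w = 0" if "L w = 0" for w
  proof -
    have "(\<Sum>i=1..n. (w \<bullet> h i) *\<^sub>R V i s) = 0"
      using that c by (intro tangent_space_eqI[OF T tangent_space_zero]) (auto simp: L_def tvec_apply)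
    then have "w \<bullet> h i = 0" if "i \<in> {1..n}" for i
      using frame_independent[OF s, of i "\<lambda>i. w \<bullet> h i"] that by simp
    then have "\<forall>b\<in>h ` {1..n}. w \<bullet> b = 0"
      by blast
    then show ?thesis
      unfolding bij_betw_imp_surj_on[OF h] euclidean_all_zero_iff .
  qed
  ultimately have "surj L"
    by (intro linear_injective_imp_surjective) (auto simp: linear_injective_0)
  then obtain w where w: "X c = L w"
    by (metis surjD)
  have expand: "X = (\<Sum>i=1..n. (w \<bullet> h i) *\<^sub>R V i s)"
    using w c by (intro tangent_space_eqI[OF X T]) (auto simp: L_def tvec_apply)
  have "\<epsilon> (j - 1) * g (\<alpha> s) (V j s) X = w \<bullet> h j" if j: "1 \<le> j" "j \<le> n" for j
  proof -
    have "g (\<alpha> s) (V j s) X = g (\<alpha> s) X (V j s)"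
      using s j X by (intro metric_sym curve_in_topspace frame_tangent)
    also have "\<dots> = (w \<bullet> h j) * \<epsilon> (j - 1)"
      using metric_frame_combination[OF s j] unfolding expand by simp
    finally show ?thesis
      using sign_sq[of "j - 1"] j by (simp add: mult.left_commute)
  qed
  then show ?thesis
    by (subst expand) (intro sum.cong, auto)
qed

definition curv :: "nat \<Rightarrow> real \<Rightarrow> real"
  where "curv i s = (if 1 \<le> i \<and> i < n then k i s else 0)"

lemma cov_deriv_frame:
  assumes "s \<in> I" and "1 \<le> i" and "i \<le> n"
  shows "cov_deriv A nabla \<alpha> (V i) s
    = - (\<epsilon> (i - 2) * \<epsilon> (i - 1) * curv (i - 1) s) *\<^sub>R V (i - 1) s + curv i s *\<^sub>R V (i + 1) s"
proof -
  consider "i = 1" | "1 < i" "i < n" | "i = n"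
    using assms by linarith
  then show ?thesis
  proof cases
    case 1
    then show ?thesis
      using Frenet_first[OF \<open>s \<in> I\<close>] order_ge_3 by (simp add: curv_def numeral_2_eq_2)
  next
    case 2
    then have "curv (i - 1) s = k (i - 1) s" "curv i s = k i s"
      by (auto simp: curv_def)
    then show ?thesis
      using Frenet_middle[OF \<open>s \<in> I\<close> 2] by simp
  next
    case 3
    then have "curv (i - 1) s = k (i - 1) s" "curv i s = 0"
      using order_ge_3 by (auto simp: curv_def)
    then show ?thesis
      using 3 Frenet_last[OF \<open>s \<in> I\<close>] by simp
  qed
qed

definition frenet_rhs :: "(nat \<Rightarrow> real \<Rightarrow> real) \<Rightarrow> nat \<Rightarrow> real \<Rightarrow> real"
  where "frenet_rhs x j s
    = - (\<epsilon> (j - 2) * \<epsilon> (j - 1) * curv (j - 1) s) * x (j - 1) s + curv j s * x (j + 1) s"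

lemma frenet_system_iff:
  "frenet_system n I \<epsilon> k x \<longleftrightarrow>
    (\<forall>s\<in>I. \<forall>j. 1 \<le> j \<and> j \<le> n \<longrightarrow> (x j has_real_derivative frenet_rhs x j s) (at s))"
proof -
  have first: "frenet_rhs x 1 s = k 1 s * x 2 s" for s
    using order_ge_3 by (simp add: frenet_rhs_def curv_def numeral_2_eq_2)
  have middle: "frenet_rhs x i s
      = - (\<epsilon> (i - 2) * \<epsilon> (i - 1) * k (i - 1) s) * x (i - 1) s + k i s * x (i + 1) s"
    if "1 < i" "i < n" for i s
  proof -
    have "curv (i - 1) s = k (i - 1) s" "curv i s = k i s"
      using that by (auto simp: curv_def)
    then show ?thesis
      by (simp add: frenet_rhs_def)
  qed
  have last: "frenet_rhs x n s = - (\<epsilon> (n - 2) * \<epsilon> (n - 1) * k (n - 1) s) * x (n - 1) s" for s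
    using order_ge_3 by (simp add: frenet_rhs_def curv_def)
  have split: "(\<forall>j. 1 \<le> j \<and> j \<le> n \<longrightarrow> P j) \<longleftrightarrow> P 1 \<and> (\<forall>j. 1 < j \<and> j < n \<longrightarrow> P j) \<and> P n"
    for P :: "nat \<Rightarrow> bool"
  proof -
    have "1 \<le> j \<and> j \<le> n \<longleftrightarrow> j = 1 \<or> (1 < j \<and> j < n) \<or> j = n" for j
      using order_ge_3 by linarith
    then show ?thesis
      by (simp only: imp_disjL all_conj_distrib simp_thms)
  qed
  show ?thesis
    unfolding split frenet_system_def first[symmetric] last[symmetric]
    using middle by auto
qed

lemma cov_deriv_frame_combination:
  assumes x: "\<And>i. 1 \<le> i \<Longrightarrow> i \<le> n \<Longrightarrow> smooth_on I (x i)" and s: "s \<in> I"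
  shows "cov_deriv A nabla \<alpha> (\<lambda>t. \<Sum>i=1..n. (\<epsilon> (i - 1) * x i t) *\<^sub>R V i t) s
    = (\<Sum>j=1..n. (\<epsilon> (j - 1) * (deriv (x j) s - frenet_rhs x j s)) *\<^sub>R V j s)"
proof -
  define down where "down j = (\<epsilon> (j - 1) * (curv j s * x (j + 1) s)) *\<^sub>R V j s" for j
  define up where "up j = (\<epsilon> (j - 1) * (curv j s * x j s)) *\<^sub>R V (j + 1) s" for j
  have d: "deriv (\<lambda>t. \<epsilon> (i - 1) * x i t) s = \<epsilon> (i - 1) * deriv (x i) s" if "1 \<le> i" "i \<le> n" for i
    using smooth_on_has_field_derivative[OF x[OF that] s] by (intro DERIV_imp_deriv DERIV_cmult)
  have sq: "\<epsilon> (i - 1) * (\<epsilon> (i - 1) * y) = y" if "1 \<le> i" "i \<le> n" for i y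
    using sign_sq[of "i - 1"] that by (simp add: mult.assoc[symmetric])
  have "cov_deriv A nabla \<alpha> (\<lambda>t. \<Sum>i=1..n. (\<epsilon> (i - 1) * x i t) *\<^sub>R V i t) s
    = (\<Sum>i=1..n. deriv (\<lambda>t. \<epsilon> (i - 1) * x i t) s *\<^sub>R V i s
        + (\<epsilon> (i - 1) * x i s) *\<^sub>R cov_deriv A nabla \<alpha> (V i) s)"
    using x by (intro cov_deriv_combination s smooth_on_mult smooth_on_const open_I frame_field) auto
  also have "\<dots> = (\<Sum>i=1..n. (\<epsilon> (i - 1) * deriv (x i) s) *\<^sub>R V i s - down (i - 1) + up i)"
  proof (intro sum.cong refl)
    fix i assume "i \<in> {1..n}"
    then have i: "1 \<le> i" "i \<le> n" by auto
    have "\<epsilon> (i - 1) * x i s * - (\<epsilon> (i - 2) * \<epsilon> (i - 1) * curv (i - 1) s)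
        = - (\<epsilon> (i - 2) * (curv (i - 1) s * x i s))"
      using sq[OF i, of "\<epsilon> (i - 2) * (curv (i - 1) s * x i s)"] by (simp add: mult_ac)
    moreover have "i - 1 - 1 = i - 2" "i - 1 + 1 = i"
      using i by auto
    ultimately show "deriv (\<lambda>t. \<epsilon> (i - 1) * x i t) s *\<^sub>R V i s
        + (\<epsilon> (i - 1) * x i s) *\<^sub>R cov_deriv A nabla \<alpha> (V i) s
      = (\<epsilon> (i - 1) * deriv (x i) s) *\<^sub>R V i s - down (i - 1) + up i"
      unfolding cov_deriv_frame[OF s i] d[OF i] down_def up_def scaleR_add_right scaleR_scaleR
      by (simp add: mult_ac)
  qed
  also have "\<dots> = (\<Sum>i=1..n. (\<epsilon> (i - 1) * deriv (x i) s) *\<^sub>R V i s)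
      - (\<Sum>i=1..n. down (i - 1)) + (\<Sum>i=1..n. up i)"
    by (simp only: sum.distrib sum_subtractf)
  also have "\<dots> = (\<Sum>i=1..n. (\<epsilon> (i - 1) * deriv (x i) s) *\<^sub>R V i s)
      - (\<Sum>i=1..n. down i) + (\<Sum>i=1..n. up (i - 1))"
  proof -
    have "curv 0 s = 0" "curv n s = 0"
      by (simp_all add: curv_def)
    then have "down 0 = 0" "down n = 0" "up 0 = 0" "up n = 0"
      by (simp_all add: down_def up_def)
    then show ?thesis
      by (simp only: sum_shift)
  qed
  also have "\<dots> = (\<Sum>i=1..n. (\<epsilon> (i - 1) * deriv (x i) s) *\<^sub>R V i s - down i + up (i - 1))"
    by (simp only: sum.distrib sum_subtractf)
  also have "\<dots> = (\<Sum>j=1..n. (\<epsilon> (j - 1) * (deriv (x j) s - frenet_rhs x j s)) *\<^sub>R V j s)"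
  proof (intro sum.cong refl)
    fix i assume "i \<in> {1..n}"
    then have i: "1 \<le> i" "i \<le> n" by auto
    have up: "up (i - 1) = (\<epsilon> (i - 1) * (\<epsilon> (i - 2) * \<epsilon> (i - 1) * curv (i - 1) s * x (i - 1) s)) *\<^sub>R V i s"
    proof -
      have "i - 1 - 1 = i - 2" "i - 1 + 1 = i"
        using i by auto
      then show ?thesis
        using sq[OF i, of "\<epsilon> (i - 2) * (curv (i - 1) s * x (i - 1) s)"]
        unfolding up_def by (simp add: mult_ac)
    qed
    show "(\<epsilon> (i - 1) * deriv (x i) s) *\<^sub>R V i s - down i + up (i - 1)
      = (\<epsilon> (i - 1) * (deriv (x i) s - frenet_rhs x i s)) *\<^sub>R V i s"
      unfolding up down_def frenet_rhs_def scaleR_left_diff_distrib[symmetric]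
        scaleR_left_distrib[symmetric]
      by (rule arg_cong[where f="\<lambda>r. r *\<^sub>R V i s"]) (simp add: algebra_simps)
  qed
  finally show ?thesis .
qed

lemma parallel_iff_frenet_system:
  assumes x: "\<And>i. 1 \<le> i \<Longrightarrow> i \<le> n \<Longrightarrow> smooth_on I (x i)"
  shows "(\<forall>s\<in>I. cov_deriv A nabla \<alpha> (\<lambda>t. \<Sum>i=1..n. (\<epsilon> (i - 1) * x i t) *\<^sub>R V i t) s = 0)
    \<longleftrightarrow> frenet_system n I \<epsilon> k x"
proof -
  have "cov_deriv A nabla \<alpha> (\<lambda>t. \<Sum>i=1..n. (\<epsilon> (i - 1) * x i t) *\<^sub>R V i t) s = 0 \<longleftrightarrow>
      (\<forall>j. 1 \<le> j \<and> j \<le> n \<longrightarrow> (x j has_real_derivative frenet_rhs x j s) (at s))"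
    (is "?D = 0 \<longleftrightarrow> _") if s: "s \<in> I" for s
  proof -
    have eq: "?D = (\<Sum>j=1..n. (\<epsilon> (j - 1) * (deriv (x j) s - frenet_rhs x j s)) *\<^sub>R V j s)"
      using x s by (rule cov_deriv_frame_combination)
    have "?D = 0 \<longleftrightarrow> (\<forall>j. 1 \<le> j \<and> j \<le> n \<longrightarrow> deriv (x j) s = frenet_rhs x j s)"
    proof
      assume "?D = 0"
      show "\<forall>j. 1 \<le> j \<and> j \<le> n \<longrightarrow> deriv (x j) s = frenet_rhs x j s"
      proof (intro allI impI)
        fix j assume j: "1 \<le> j \<and> j \<le> n"
        have "\<epsilon> (j - 1) * (deriv (x j) s - frenet_rhs x j s) = 0"
          using \<open>?D = 0\<close> j unfolding eq
          by (intro frame_independent[OF s, of j "\<lambda>j. \<epsilon> (j - 1) * (deriv (x j) s - frenet_rhs x j s)"]) auto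
        moreover have "\<epsilon> (j - 1) \<noteq> 0"
          by (rule sign_nonzero) (use j in linarith)
        ultimately show "deriv (x j) s = frenet_rhs x j s"
          by simp
      qed
    next
      assume "\<forall>j. 1 \<le> j \<and> j \<le> n \<longrightarrow> deriv (x j) s = frenet_rhs x j s"
      then show "?D = 0"
        unfolding eq by (intro sum.neutral) simp
    qed
    moreover have "deriv (x j) s = frenet_rhs x j s \<longleftrightarrow>
        (x j has_real_derivative frenet_rhs x j s) (at s)" if "1 \<le> j" "j \<le> n" for j
      using smooth_on_has_field_derivative[OF x[OF that] s] DERIV_imp_deriv by metis
    ultimately show ?thesis by blast
  qed
  then show ?thesis
    unfolding frenet_system_iff by blast
qed

lemma smooth_on_curvature:
  assumes i: "1 \<le> i" "i < n"
  shows "smooth_on I (k i)"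
proof (rule smooth_on_cong[OF open_I])
  have D: "vector_field_along A I \<alpha> (cov_deriv A nabla \<alpha> (V i))"
    unfolding vector_field_along_def
  proof (intro conjI ballI)
    show "cov_deriv A nabla \<alpha> (V i) s \<in> tangent_space A (\<alpha> s)" if s: "s \<in> I" for s
    proof (cases "i = 1")
      case True
      then show ?thesis
        using Frenet_first[OF s] frame_tangent[OF s, of 2] i by (auto intro: tangent_space_scaleR)
    next
      case False
      then have "1 < i" using i by simp
      then show ?thesis
        unfolding Frenet_middle[OF s \<open>1 < i\<close> i(2)] using i s
        by (intro tangent_space_add tangent_space_scaleR frame_tangent) auto
    qed
    show "smooth_on (chart_time c) (\<lambda>s. cov_deriv A nabla \<alpha> (V i) s c)" if "c \<in> A" for c
      using i that by (intro smooth_on_cov_deriv frame_field) auto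
  qed
  show "smooth_on I (\<lambda>s. \<epsilon> i * g (\<alpha> s) (cov_deriv A nabla \<alpha> (V i) s) (V (i + 1) s))"
    using i by (intro smooth_on_mult smooth_on_const open_I smooth_on_metric D frame_field) auto
  show "\<epsilon> i * g (\<alpha> s) (cov_deriv A nabla \<alpha> (V i) s) (V (i + 1) s) = k i s" if s: "s \<in> I" for s
  proof -
    define u where "u j = (if j = i + 1 then k i s else if j + 1 = i then
      - (\<epsilon> (i - 2) * \<epsilon> (i - 1) * k (i - 1) s) else 0)" for j
    have "cov_deriv A nabla \<alpha> (V i) s = (\<Sum>j=1..n. u j *\<^sub>R V j s)"
    proof (cases "i = 1")
      case True
      have "(\<Sum>j=1..n. u j *\<^sub>R V j s) = (\<Sum>j\<in>{2}. u j *\<^sub>R V j s)"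
        using i True by (intro sum.mono_neutral_right) (auto simp: u_def)
      then show ?thesis
        using True Frenet_first[OF s] by (simp add: u_def)
    next
      case False
      then have "1 < i" using i by simp
      have "(\<Sum>j=1..n. u j *\<^sub>R V j s) = (\<Sum>j\<in>{i - 1, i + 1}. u j *\<^sub>R V j s)"
        using i False by (intro sum.mono_neutral_right) (auto simp: u_def)
      moreover have "i - 1 \<noteq> i + 1" "i - 1 + 1 = i"
        using \<open>1 < i\<close> by auto
      ultimately show ?thesis
        using Frenet_middle[OF s \<open>1 < i\<close> i(2)] by (simp add: u_def add.commute)
    qed
    then have "g (\<alpha> s) (cov_deriv A nabla \<alpha> (V i) s) (V (i + 1) s) = k i s * \<epsilon> i"
      using metric_frame_combination[OF s, of "i + 1" u] i by (simp add: u_def)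
    then show ?thesis
      using sign_sq[OF i(2)] by simp
  qed
qed

lemma slant_helix_iff:
  "slant_helix M A g nabla n I \<alpha> V \<epsilon> k \<longleftrightarrow>
    (\<exists>x r. (\<forall>i. 1 \<le> i \<and> i \<le> n \<longrightarrow> smooth_on I (x i)) \<and> frenet_system n I \<epsilon> k x \<and>
      r \<noteq> 0 \<and> (\<forall>s\<in>I. x n s = r))" (is "?L \<longleftrightarrow> ?R")
proof
  assume ?L
  then obtain X r where X: "vector_field_along A I \<alpha> X"
    and par: "\<And>s. s \<in> I \<Longrightarrow> cov_deriv A nabla \<alpha> X s = 0"
    and r: "r \<noteq> 0" "\<And>s. s \<in> I \<Longrightarrow> g (\<alpha> s) (V n s) (X s) = r"
    unfolding slant_helix_def by blast
  define x where "x i s = g (\<alpha> s) (V i s) (X s)" for i s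
  have smooth: "smooth_on I (x i)" if "1 \<le> i" "i \<le> n" for i
    unfolding x_def using that by (intro smooth_on_metric frame_field X)
  have expand: "X s = (\<Sum>i=1..n. (\<epsilon> (i - 1) * x i s) *\<^sub>R V i s)" if "s \<in> I" for s
    unfolding x_def by (rule frame_expansion[OF that vector_field_along_tangent[OF X that]])
  have "cov_deriv A nabla \<alpha> (\<lambda>t. \<Sum>i=1..n. (\<epsilon> (i - 1) * x i t) *\<^sub>R V i t) s = 0"
    if "s \<in> I" for s
    using cov_deriv_cong[OF expand that] par[OF that] by simp
  then have "frenet_system n I \<epsilon> k x"
    using parallel_iff_frenet_system[of x] smooth by simp
  moreover have "\<forall>s\<in>I. x n s = r"
    by (simp add: x_def r(2))
  ultimately show ?R
    using smooth r(1) by (intro exI[of _ x] exI[of _ r]) simp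
next
  assume ?R
  then obtain x r where smooth: "\<And>i. 1 \<le> i \<Longrightarrow> i \<le> n \<Longrightarrow> smooth_on I (x i)"
    and sys: "frenet_system n I \<epsilon> k x" and r: "r \<noteq> 0" "\<And>s. s \<in> I \<Longrightarrow> x n s = r"
    by blast
  define X where "X t = (\<Sum>i=1..n. (\<epsilon> (i - 1) * x i t) *\<^sub>R V i t)" for t
  have X: "vector_field_along A I \<alpha> X"
    unfolding X_def
    by (intro vector_field_along_combination smooth_on_mult smooth_on_const open_I frame_field)
       (auto intro: smooth)
  have "\<forall>s\<in>I. cov_deriv A nabla \<alpha> X s = 0"
    unfolding X_def using parallel_iff_frenet_system[of x] smooth sys by simp
  moreover have "g (\<alpha> s) (V n s) (X s) = r" if s: "s \<in> I" for s
  proof -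
    have n: "1 \<le> n" "n \<le> n" "n - 1 < n"
      using order_ge_3 by auto
    have "g (\<alpha> s) (V n s) (X s) = g (\<alpha> s) (X s) (V n s)"
      using s n X by (intro metric_sym curve_in_topspace frame_tangent vector_field_along_tangent)
    also have "\<dots> = \<epsilon> (n - 1) * x n s * \<epsilon> (n - 1)"
      unfolding X_def by (rule metric_frame_combination[OF s n(1,2)])
    also have "\<dots> = r"
      using sign_sq[OF n(3)] r(2)[OF s] by (simp add: mult_ac)
    finally show ?thesis .
  qed
  ultimately show ?L
    unfolding slant_helix_def using X r(1) proper_curve_axioms by blast
qed

lemma slant_helix_iff_harmonic_condition:
  "slant_helix M A g nabla n I \<alpha> V \<epsilon> k \<longleftrightarrow>
    (\<forall>s\<in>I. deriv (H (n - 2)) s = k 1 s * H (n - 3) s) \<and> (\<exists>s\<in>I. H (n - 2) s \<noteq> 0)"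
proof
  assume "slant_helix M A g nabla n I \<alpha> V \<epsilon> k"
  then obtain x r where "frenet_system n I \<epsilon> k x" "r \<noteq> 0" "\<And>s. s \<in> I \<Longrightarrow> x n s = r"
    unfolding slant_helix_iff by blast
  then show "(\<forall>s\<in>I. deriv (H (n - 2)) s = k 1 s * H (n - 3) s) \<and> (\<exists>s\<in>I. H (n - 2) s \<noteq> 0)"
    using frenet_system_imp_harmonic_condition[of x r] interval(3) by blast
next
  assume "(\<forall>s\<in>I. deriv (H (n - 2)) s = k 1 s * H (n - 3) s) \<and> (\<exists>s\<in>I. H (n - 2) s \<noteq> 0)"
  then have cond: "\<forall>s\<in>I. deriv (H (n - 2)) s = k 1 s * H (n - 3) s" ..
  let ?x = "\<lambda>i. if i = n then (\<lambda>_. 1) else H (n - 1 - i)"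
  have smooth_H: "smooth_on I (H i)" if "i \<le> n - 2" for i
    using smooth_on_curvature that by (rule smooth_on_harmonic_curvature)
  then have "smooth_on I (?x i)" if "1 \<le> i" "i \<le> n" for i
    using that by (simp add: smooth_on_const open_I)
  moreover have "frenet_system n I \<epsilon> k ?x"
    using smooth_H cond by (rule harmonic_condition_imp_frenet_system)
  moreover have "\<forall>s\<in>I. ?x n s = 1"
    by simp
  ultimately show "slant_helix M A g nabla n I \<alpha> V \<epsilon> k"
    unfolding slant_helix_iff by (intro exI[of _ ?x] exI[of _ 1]) simp
qed

end

theorem corollary3p1:
  fixes M :: "'a topology" and A :: "('a, 'e::euclidean_space) chart set"
    and g :: "'a \<Rightarrow> ('a, 'e) tvec \<Rightarrow> ('a, 'e) tvec \<Rightarrow> real"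
    and nabla :: "'a \<Rightarrow> ('a, 'e) tvec \<Rightarrow> ('a \<Rightarrow> ('a, 'e) tvec) \<Rightarrow> ('a, 'e) tvec"
    and n :: nat and I :: "real set" and \<alpha> :: "real \<Rightarrow> 'a"
    and V :: "nat \<Rightarrow> real \<Rightarrow> ('a, 'e) tvec"
    and \<epsilon> :: "nat \<Rightarrow> real" and k :: "nat \<Rightarrow> real \<Rightarrow> real"
  assumes "pseudo_riemannian_manifold M A g"
    and "levi_civita_connection M A g nabla"
    and "n = DIM('e)" and "n \<ge> 3"
    and "proper_curve M A g nabla n I \<alpha> V \<epsilon> k"
  shows "slant_helix M A g nabla n I \<alpha> V \<epsilon> k \<longleftrightarrow>
    (\<forall>s\<in>I. deriv (harmonic_curvature n \<epsilon> k (n - 2)) s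
           = k 1 s * harmonic_curvature n \<epsilon> k (n - 3) s) \<and>
    (\<exists>s\<in>I. harmonic_curvature n \<epsilon> k (n - 2) s \<noteq> 0)"
proof -
  interpret long_proper_curve M A g nabla n I \<alpha> V \<epsilon> k
    using assms by (intro long_proper_curve.intro long_proper_curve_axioms.intro)
  show ?thesis
    by (rule slant_helix_iff_harmonic_condition)
qed

end
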